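(* For every $\varepsilon\in(0,1)$ there is $n_\varepsilon\in\mathbb N$ such that $$\mathrm{IR}(\vec{\mathcal T}_n)\le \big(4e(1+\varepsilon)\,n^2\ln n\big)^n\quad\text{for all } n\ge n_\varepsilon .$$
   Context: Graphs are simple and undirected. A digraph has neither loops nor pairs of opposite arcs. An orientation $\vec G$ of a graph $G$ is a digraph on $V_G$ obtained by replacing each edge $\{a,b\}$ by exactly one of $(a,b)$, $(b,a)$. The distance $d_G(u,v)$ is the smallest number of edges of a path in $G$ joining $u$ and $v$ ($\infty$ if there is none); distance in a digraph is the distance in its underlying undirected graph. For a graph $G$ and a digraph $\vec H$, $G\Rightarrow\vec H$ means: for every orientation $\vec G$ of $G$ there is an injective map $f:V_{\vec H}\to V_G$ such that (i) for all $u,v\in V_{\vec H}$, $(u,v)\in E_{\vec H}$ if and only if $(f(u),f(v))\in E_{\vec G}$, and (ii) $d_{\vec H}(u,v)=d_G(f(u),f(v))$ for all $u,v\in V_{\vec H}$. For a class $\vec{\mathcal H}$ of digraphs, $G\Rightarrow\vec{\mathcal H}$ means $G\Rightarrow\vec H$ for every $\vec H\in\vec{\mathcal H}$, and $\mathrm{IR}(\vec{\mathcal H})$ is the smallest number of vertices of a graph $G$ with $G\Rightarrow\vec{\mathcal H}$. $\vec{\mathcal T}_n$ denotes the class of all oriented trees (orientations of trees) on $n$ vertices. *)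

theory Defs
  imports Complex_Main "HOL-Library.Extended_Real" "Graph_Theory.Graph_Theory"
begin

text \<open>
  A finite simple undirected graph is a \<^locale>\<open>pair_graph\<close>: a finite loop-free digraph with a symmetric
  arc relation, in which the edge between \<open>a\<close> and \<open>b\<close> is the pair of arcs \<open>(a,b)\<close>, \<open>(b,a)\<close>.
\<close>

definition orientation_of :: "'a pair_pre_digraph \<Rightarrow> 'a pair_pre_digraph \<Rightarrow> bool" where
  "orientation_of D G \<longleftrightarrow>
     pverts D = pverts G \<and> parcs D \<subseteq> parcs G \<and>
     (\<forall>(a, b) \<in> parcs G. ((a, b) \<in> parcs D) \<noteq> ((b, a) \<in> parcs D))"

text \<open>The infimum over the empty set is \<open>\<infinity>\<close>.\<close>

definition graph_dist :: "'a pair_pre_digraph \<Rightarrow> 'a \<Rightarrow> 'a \<Rightarrow> enat" where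
  "graph_dist G u v = (INF p \<in> {p. pre_digraph.apath (with_proj G) u p v}. enat (length p))"

definition digraph_dist :: "'a pair_pre_digraph \<Rightarrow> 'a \<Rightarrow> 'a \<Rightarrow> enat" where
  "digraph_dist D u v = graph_dist (mk_symmetric (with_proj D)) u v"

definition arrows :: "'a pair_pre_digraph \<Rightarrow> 'b pair_pre_digraph \<Rightarrow> bool" where
  "arrows G H \<longleftrightarrow>
     (\<forall>D. orientation_of D G \<longrightarrow>
        (\<exists>f. f ` pverts H \<subseteq> pverts G \<and> inj_on f (pverts H) \<and>
           (\<forall>u \<in> pverts H. \<forall>v \<in> pverts H. (u, v) \<in> parcs H \<longleftrightarrow> (f u, f v) \<in> parcs D) \<and>
           (\<forall>u \<in> pverts H. \<forall>v \<in> pverts H. digraph_dist H u v = graph_dist G (f u) (f v))))"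

definition arrows_class :: "'a pair_pre_digraph \<Rightarrow> 'b pair_pre_digraph set \<Rightarrow> bool" where
  "arrows_class G \<H> \<longleftrightarrow> (\<forall>H \<in> \<H>. arrows G H)"

text \<open>
  Every finite graph is isomorphic to one with vertices in \<^typ>\<open>nat\<close>, so it suffices to consider those.
  The value is \<open>\<infinity>\<close> if no graph \<open>G\<close> is suitable; otherwise the infimum is a minimum.
\<close>

definition IR :: "'b pair_pre_digraph set \<Rightarrow> enat" where
  "IR \<H> = Inf {enat (card (pverts G)) | G :: nat pair_pre_digraph. pair_graph G \<and> arrows_class G \<H>}"

text \<open>
  \<^const>\<open>tree\<close> from the library concerns directed cycles, and an edge \<open>{a,b}\<close> of a symmetric
  digraph already gives the directed cycle \<open>a b a\<close>. The cycles of the undirected graph are the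
  directed cycles of length at least \<open>3\<close>.
\<close>

definition undirected_tree :: "'a pair_pre_digraph \<Rightarrow> bool" where
  "undirected_tree T \<longleftrightarrow>
     pair_graph T \<and> connected (with_proj T) \<and>
     \<not> (\<exists>p. pre_digraph.cycle (with_proj T) p \<and> 3 \<le> length p)"

text \<open>One representative (at least) of each isomorphism class, with vertices in \<^typ>\<open>nat\<close>.\<close>

definition oriented_trees :: "nat \<Rightarrow> nat pair_pre_digraph set" where
  "oriented_trees n = {D. \<exists>T. undirected_tree T \<and> card (pverts T) = n \<and> orientation_of D T}"

lemma orientation_of_pair_digraph:
  assumes "pair_graph G" "orientation_of D G"
  shows "pair_digraph D" "asym (parcs D)"
proof -
  interpret pair_graph G by fact
  have fin: "finite (parcs D)"
    using assms(2) pair_finite_arcs unfolding orientation_of_def by (auto intro: finite_subset)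
  have sub: "(a, b) \<in> parcs G" if "(a, b) \<in> parcs D" for a b
    using assms(2) that unfolding orientation_of_def by blast
  have verts: "pverts D = pverts G"
    using assms(2) unfolding orientation_of_def by blast
  show "pair_digraph D"
    using fin pair_finite_verts
    by unfold_locales (auto simp: verts dest!: sub dest: wellformed' pair_no_loops)
  show "asym (parcs D)"
    using assms(2) sub unfolding orientation_of_def by (intro asymI) blast
qed

lemma orientation_of_underlying:
  assumes "pair_graph G" "orientation_of D G"
  shows "mk_symmetric (with_proj D) = G"
proof -
  interpret pair_graph G by fact
  have "sym (parcs G)"
    using pair_sym_arcs by (simp add: symmetric_def)
  then have "parcs (mk_symmetric (with_proj D)) = parcs G"
    using assms(2) unfolding orientation_of_def parcs_mk_symmetric by (fastforce dest: symD)
  then show ?thesis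
    using assms(2) unfolding orientation_of_def by (intro pair_pre_digraph.equality) auto
qed

end

theory Submission
  imports Defs "HOL-Real_Asymp.Real_Asymp"
begin

text \<open>
  The graph is a random graph \<open>G(N,p)\<close> with \<open>N = \<lfloor>M ^ n\<rfloor>\<close>, \<open>M = 4 e n\<^sup>2 ln n\<close>, and \<open>p N = M / e\<close>. An oriented
  tree is embedded leaf by leaf. A new leaf attached at the image \<open>v\<close> of its neighbour keeps the
  embedding isometric unless it is the first vertex of a path with at most \<open>n - 1\<close> edges from \<open>v\<close> to
  another vertex \<open>u\<close> of the image. If more than \<open>k\<close> neighbours of \<open>v\<close> are excluded by one \<open>u\<close>, then
  \<open>k + 1\<close> ears at \<open>v\<close> can be chosen one after the other, each of expected number at most
  \<open>exp (- n)\<close>; with \<open>k\<close> about \<open>ln M\<close> this concerns few vertices \<open>v\<close>. On the other hand every set of at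
  least \<open>N / (40 n)\<close> vertices spans more than \<open>3/4\<close> of the expected number of edges, so that in every orientation only
  few vertices have to be discarded to guarantee more than \<open>j k\<close> out-neighbours (or in-neighbours) when
  the tree already has \<open>j\<close> vertices.
\<close>

section \<open>Walks and distances\<close>

text \<open>The list \<open>w # xs\<close> has one entry per edge of the path from \<open>v\<close>,
  so \<open>m\<close> bounds the number of edges. The case \<open>xs = []\<close> makes a neighbour
  \<open>u\<close> of \<open>v\<close> a start for itself.\<close>

definition short_starts :: "'a rel \<Rightarrow> nat \<Rightarrow> 'a \<Rightarrow> 'a \<Rightarrow> 'a set" where
  "short_starts R m v u =
     {w. \<exists>xs. distinct (v # w # xs) \<and> successively (\<lambda>a b. (a, b) \<in> R) (v # w # xs) \<and>
        last (w # xs) = u \<and> length (w # xs) \<le> m}"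

lemma relpow_sym:
  assumes "sym R" "(x, y) \<in> R ^^ m"
  shows "(y, x) \<in> R ^^ m"
  using assms(2)
proof (induction m arbitrary: y)
  case (Suc m)
  then obtain z where "(x, z) \<in> R ^^ m" "(z, y) \<in> R"
    by auto
  with Suc.IH assms(1) have "(y, z) \<in> R" "(z, x) \<in> R ^^ m"
    by (auto dest: symD)
  then show ?case
    by (rule relpow_Suc_I2)
qed auto

lemma (in wf_digraph) length_awalk_to_apath_le:
  assumes "awalk u p v"
  shows "\<exists>q. apath u q v \<and> length q \<le> length p"
  using assms
proof (induct rule: awalk_to_apath_induct)
  case (path p)
  then show ?case by (auto simp: apath_def)
next
  case (decomp p q r s)
  then have "p = q @ r @ s"
    using awalk_cyc_decomp_has_prop[OF decomp(1)] by auto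
  with decomp(4) show ?case by fastforce
qed

context pair_wf_digraph
begin

lemma awalk_of_relpow:
  assumes "u \<in> pverts G" "(u, v) \<in> parcs G ^^ m"
  shows "\<exists>p. awalk u p v \<and> length p = m"
  using assms
proof (induction m arbitrary: u)
  case 0
  then show ?case by (auto intro!: exI[of _ "[]"] simp: awalk_Nil_iff)
next
  case (Suc m)
  then obtain z where z: "(u, z) \<in> parcs G" "(z, v) \<in> parcs G ^^ m"
    by (metis relpow_Suc_E2)
  with Suc.IH[of z] obtain p where "awalk z p v" "length p = m"
    using in_arcsD2 by blast
  with z show ?case
    by (intro exI[of _ "(u, z) # p"]) (auto simp: awalk_Cons_iff)
qed

text \<open>Relation powers describe walks, whereas \<open>graph_dist\<close> is an infimum over
  simple paths; cutting cycles out of a walk never lengthens it.\<close>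

lemma graph_dist_le_if_relpow:
  assumes "u \<in> pverts G" "(u, v) \<in> parcs G ^^ m"
  shows "graph_dist G u v \<le> enat m"
proof -
  obtain p where "awalk u p v" "length p = m"
    using awalk_of_relpow[OF assms] by blast
  then obtain q where "apath u q v" "length q \<le> m"
    using length_awalk_to_apath_le by blast
  then show ?thesis
    unfolding graph_dist_def by (intro INF_lower2[of q]) auto
qed

lemma successively_pawalk_verts:
  "pcas u p v \<Longrightarrow> set p \<subseteq> parcs G \<Longrightarrow> successively (\<lambda>a b. (a, b) \<in> parcs G) (pawalk_verts u p)"
proof (induction p arbitrary: u)
  case (Cons e p)
  then show ?case by (cases e; cases p) auto
qed auto

lemma graph_dist_leE:
  assumes "graph_dist G u v \<le> enat m"
  obtains xs where "distinct (u # xs)" "successively (\<lambda>a b. (a, b) \<in> parcs G) (u # xs)"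
    "last (u # xs) = v" "length xs \<le> m"
proof -
  define Q where "Q = (\<lambda>p. enat (length p)) ` {p. apath u p v}"
  have Inf: "Inf Q \<le> enat m"
    using assms by (simp add: graph_dist_def Q_def)
  \<comment> \<open>An empty \<open>Q\<close> would have infinite infimum. A nonempty set of
    \<open>enat\<close> contains its infimum, so a path of minimal length exists.\<close>
  then have "Q \<noteq> {}"
    by (auto simp: Inf_enat_def)
  then have "Inf Q \<in> Q"
    unfolding Inf_enat_def using LeastI_ex[of "\<lambda>x. x \<in> Q"] by (simp add: ex_in_conv)
  with Inf obtain i where i: "i \<in> Q" "i \<le> enat m"
    by blast
  from i(1) obtain p where "p \<in> {p. apath u p v}" "i = enat (length p)"
    unfolding Q_def by (rule imageE)
  with i(2) have p: "apath u p v" "length p \<le> m"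
    by simp_all
  then have w: "awalk u p v" and dist: "distinct (pawalk_verts u p)"
    by (auto simp: apath_def)
  have *: "pawalk_verts u p = u # tl (pawalk_verts u p)"
    using w by (cases p) (auto simp: awalk_Cons_iff)
  show ?thesis
  proof (rule that)
    show "distinct (u # tl (pawalk_verts u p))"
      using dist unfolding *[symmetric] .
    show "successively (\<lambda>a b. (a, b) \<in> parcs G) (u # tl (pawalk_verts u p))"
      using w successively_pawalk_verts[of u p v] unfolding *[symmetric] awalk_def by auto
    show "last (u # tl (pawalk_verts u p)) = v"
      using w unfolding *[symmetric] by auto
    show "length (tl (pawalk_verts u p)) \<le> m"
      using p(2) length_awalk_verts[of u p] by simp
  qed
qed

end

lemma relpow_if_successively:
  assumes "successively (\<lambda>a b. (a, b) \<in> R) (u # xs)"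
  shows "(u, last (u # xs)) \<in> R ^^ length xs"
  using assms
proof (induction xs arbitrary: u)
  case (Cons x xs)
  then have "(u, x) \<in> R" "(x, last (x # xs)) \<in> R ^^ length xs"
    by auto
  then show ?case
    by (metis last_ConsR length_Cons list.distinct(1) relpow_Suc_I2)
qed auto

lemma (in pair_wf_digraph) graph_dist_le_if_path:
  assumes "u \<in> pverts G" "successively (\<lambda>a b. (a, b) \<in> parcs G) (u # xs)"
    "last (u # xs) = v" "length xs \<le> m"
  shows "graph_dist G u v \<le> enat m"
proof -
  have "graph_dist G u v \<le> enat (length xs)"
    using relpow_if_successively[OF assms(2)] assms graph_dist_le_if_relpow by simp
  also have "\<dots> \<le> enat m"
    using assms(4) by simp
  finally show ?thesis .
qed

lemma (in pair_sym_digraph) graph_dist_commute: "graph_dist G u v = graph_dist G v u"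
proof -
  have len: "length (rev_path p) = length p" for p :: "('a \<times> 'a) list"
    by (induction p) auto
  have "graph_dist G u v \<le> graph_dist G v u" for u v
    unfolding graph_dist_def
    by (rule INF_mono) (metis apath_rev_path len mem_Collect_eq order_refl)
  then show ?thesis
    by (intro antisym)
qed

section \<open>Isometric embeddings of oriented trees\<close>

text \<open>This form of oriented tree supplies the induction for the embedding: a leaf
  \<open>y\<close> is added at \<open>x\<close>, with one rule for each direction of the arc.
  \<open>otree_if_oriented_tree\<close> links it to \<open>oriented_trees\<close>.\<close>

inductive otree :: "'a set \<Rightarrow> 'a rel \<Rightarrow> bool" where
  single: "otree {x} {}"
| out: "otree S A \<Longrightarrow> x \<in> S \<Longrightarrow> y \<notin> S \<Longrightarrow> otree (insert y S) (insert (x, y) A)"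
| inward: "otree S A \<Longrightarrow> x \<in> S \<Longrightarrow> y \<notin> S \<Longrightarrow> otree (insert y S) (insert (y, x) A)"

lemma otree_finite: "otree S A \<Longrightarrow> finite S \<and> S \<noteq> {}"
  by (induction rule: otree.induct) auto

lemma otree_arcs: "otree S A \<Longrightarrow> A \<subseteq> S \<times> S"
  by (induction rule: otree.induct) auto

text \<open>
  A neighbour \<open>w\<close> of \<open>v\<close> that is too close to \<open>u\<close> is the first step of a short path from \<open>v\<close> to \<open>u\<close>.
\<close>
lemma (in pair_graph) graph_dist_extend:
  assumes "v \<in> pverts G" and vw: "(v, w) \<in> parcs G" and r: "graph_dist G v u = enat r" "r < m"
    and "u = v \<or> w \<notin> short_starts (parcs G) m v u"
  shows "graph_dist G w u = enat (Suc r)"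
proof (rule antisym)
  have wV: "w \<in> pverts G" and wv: "w \<noteq> v"
    using vw in_arcsD2 no_loops' by auto
  obtain xs where xs: "successively (\<lambda>a b. (a, b) \<in> parcs G) (v # xs)"
    "last (v # xs) = u" "length xs \<le> r"
    using graph_dist_leE[of v u r] r(1) by auto
  then show "graph_dist G w u \<le> enat (Suc r)"
    using arcs_symmetric[OF vw] wV by (intro graph_dist_le_if_path[of w "v # xs"]) auto
  show "enat (Suc r) \<le> graph_dist G w u"
  proof (rule ccontr)
    assume "\<not> ?thesis"
    then have "graph_dist G w u \<le> enat r"
      by (cases "graph_dist G w u") auto
    then obtain ys where ys: "distinct (w # ys)" "successively (\<lambda>a b. (a, b) \<in> parcs G) (w # ys)"
      "last (w # ys) = u" "length ys \<le> r"
      by (elim graph_dist_leE)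
    show False
    \<comment> \<open>If the path from \<open>w\<close> meets \<open>v\<close>, its remainder joins
      \<open>v\<close> to \<open>u\<close> with fewer than \<open>r\<close> edges. If it avoids
      \<open>v\<close>, then prefixing \<open>v\<close> makes \<open>w\<close> a short
      start.\<close>
    proof (cases "v \<in> set ys")
      case True
      then obtain as bs where "ys = as @ v # bs"
        by (meson split_list)
      then have "successively (\<lambda>a b. (a, b) \<in> parcs G) (v # bs)" "last (v # bs) = u"
        "length bs < length ys"
        using ys by (simp_all add: successively_append_iff successively_Cons split: if_splits)
      then have "graph_dist G v u \<le> enat (length bs)"
        using assms(1) by (intro graph_dist_le_if_path) auto
      then show False
        using r ys(4) \<open>length bs < length ys\<close> by simp
    next
      case False
      then have "u \<noteq> v"
        using wv ys(3) last_in_set[of "w # ys"] by auto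
      moreover have "w \<in> short_starts (parcs G) m v u"
        unfolding short_starts_def mem_Collect_eq using False wv vw ys r(2)
        by (intro exI[of _ ys]) simp
      ultimately show False
        using assms(5) by auto
    qed
  qed
qed

text \<open>Arcs are counted by their tails. In the embedding, \<open>X\<close> consists of the
  vertices with too few out-neighbours; this bound together with density keeps \<open>X\<close>
  small.\<close>

lemma card_low_degree_arcs:
  fixes P :: "'a rel" and c :: nat
  assumes "finite X" "\<And>v. v \<in> X \<Longrightarrow> card {w \<in> V. (v, w) \<in> P} \<le> c" "X \<subseteq> V" "finite V"
  shows "card (P \<inter> X \<times> X) \<le> c * card X"
proof -
  have "P \<inter> X \<times> X = Sigma X (\<lambda>v. {w \<in> X. (v, w) \<in> P})"
    by auto
  also have "card \<dots> = (\<Sum>v\<in>X. card {w \<in> X. (v, w) \<in> P})"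
    using assms(1) by (intro card_SigmaI) auto
  also have "\<dots> \<le> (\<Sum>v\<in>X. c)"
    using assms by (intro sum_mono order_trans[OF card_mono assms(2)]) auto
  finally show ?thesis
    by (simp add: mult.commute)
qed

text \<open>The tree is only asked for a walk of length \<open>m\<close>, and arcs are only
  preserved in one direction; both converses are recovered at the end, in
  \<open>arrows_oriented_tree\<close>. The bound \<open>m < card S\<close> keeps distances within
  the range that \<open>short_starts\<close> controls.\<close>

definition isometric_embedding ::
    "'a pair_pre_digraph \<Rightarrow> 'a rel \<Rightarrow> 'b set \<Rightarrow> 'b rel \<Rightarrow> ('b \<Rightarrow> 'a) \<Rightarrow> bool" where
  "isometric_embedding G P S A f \<longleftrightarrow>
     inj_on f S \<and> (\<forall>(x, y)\<in>A. (f x, f y) \<in> P) \<and>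
     (\<forall>x\<in>S. \<forall>y\<in>S. \<exists>m<card S. (x, y) \<in> (A \<union> A\<inverse>) ^^ m \<and> graph_dist G (f x) (f y) = enat m)"

text \<open>The leaf goes to a \<open>Q\<close>-neighbour of \<open>v = f x\<close> in
  \<open>V\<close> that starts no short path to another image vertex. Each such vertex excludes at
  most \<open>k\<close> candidates, in total fewer than there are, and
  \<open>graph_dist_extend\<close> then gives all distances from the leaf.\<close>

lemma (in pair_graph) isometric_embedding_extend:
  assumes tree: "otree S A" "x \<in> S" "y \<notin> S" "card S < n"
    and orient: "P \<union> P\<inverse> = parcs G"
    and f: "isometric_embedding G P S A f" "f ` S \<subseteq> V" and V: "V \<subseteq> pverts G"
    and few: "\<And>v u. v \<in> V \<Longrightarrow> u \<in> V \<Longrightarrow> u \<noteq> v \<Longrightarrow> card (short_starts (parcs G) (n - 1) v u) \<le> k"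
    and deg: "card S * k < card {w \<in> V. (f x, w) \<in> Q}" and Q: "Q \<subseteq> parcs G"
    and A': "A' = insert (x, y) A \<and> Q = P \<or> A' = insert (y, x) A \<and> Q = P\<inverse>"
  shows "\<exists>g. isometric_embedding G P (insert y S) A' g \<and> g ` insert y S \<subseteq> V"
proof -
  have fin: "finite S" "finite V"
    using otree_finite[OF tree(1)] V pair_finite_verts by (auto intro: finite_subset)
  define v where "v = f x"
  have vV: "v \<in> V" "v \<in> pverts G"
    using f(2) tree(2) V by (auto simp: v_def)
  define B where "B = (\<Union>u\<in>f ` S - {v}. short_starts (parcs G) (n - 1) v u)"
  have sub: "short_starts (parcs G) (n - 1) v u \<subseteq> pverts G" for u
    unfolding short_starts_def using in_arcsD2 by auto
  then have "finite B"
    unfolding B_def using fin(1) finite_subset[OF sub pair_finite_verts] by auto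
  have "card B \<le> (\<Sum>u\<in>f ` S - {v}. card (short_starts (parcs G) (n - 1) v u))"
    unfolding B_def using fin(1) by (intro card_UN_le) auto
  also have "\<dots> \<le> (\<Sum>u\<in>f ` S - {v}. k)"
    using few vV(1) f(2) by (intro sum_mono) auto
  also have "\<dots> \<le> card S * k"
  proof -
    have "card (f ` S - {v}) \<le> card S"
      using fin(1) by (meson Diff_subset card_image_le card_mono finite_imageI order_trans)
    then show ?thesis by simp
  qed
  finally have "card B < card {w \<in> V. (v, w) \<in> Q}"
    using deg by (simp add: v_def)
  then have "\<not> {w \<in> V. (v, w) \<in> Q} \<subseteq> B"
    using card_mono[OF \<open>finite B\<close>] by (metis leD)
  then obtain w where w: "w \<in> V" "(v, w) \<in> Q" "w \<notin> B"
    by blast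
  have vw: "(v, w) \<in> parcs G" and wv: "w \<noteq> v"
    using w(2) Q no_loops' by auto
  have "1 \<le> n - 1"
    using tree(4) card_gt_0_iff[of S] fin(1) tree(2) by (cases "card S") auto
  \<comment> \<open>An image vertex adjacent to \<open>v\<close> is excluded too, through the
    one-edge path from \<open>v\<close> to it.\<close>
  have new: "w \<notin> f ` S"
  proof
    assume "w \<in> f ` S"
    moreover have "w \<in> short_starts (parcs G) (n - 1) v w"
      unfolding short_starts_def using vw wv \<open>1 \<le> n - 1\<close> by (auto intro!: exI[of _ "[]"])
    ultimately show False
      using w(3) wv by (auto simp: B_def)
  qed
  define g where "g = f(y := w)"
  have gS: "g z = f z" if "z \<in> S" for z
    using that tree(3) by (auto simp: g_def)
  have gy: "g y = w"
    by (simp add: g_def)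
  let ?R = "A \<union> A\<inverse>" and ?R' = "A' \<union> A'\<inverse>"
  have RR': "?R ^^ m \<subseteq> ?R' ^^ m" for m
  proof (induction m)
    case (Suc m)
    moreover have "?R \<subseteq> ?R'"
      using A' by auto
    ultimately show ?case
      unfolding relpow.simps by (rule relcomp_mono)
  qed simp
  have yx: "(y, x) \<in> ?R'"
    using A' by auto
  have symR': "sym ?R'"
    by (auto intro: symI)
  have card: "card (insert y S) = Suc (card S)"
    using fin(1) tree(3) by simp
  have to_new: "\<exists>m<Suc (card S). (y, u) \<in> ?R' ^^ m \<and> (u, y) \<in> ?R' ^^ m \<and>
      graph_dist G w (f u) = enat m \<and> graph_dist G (f u) w = enat m" if u: "u \<in> S" for u
  proof -
    obtain m where m: "m < card S" "(x, u) \<in> ?R ^^ m" "graph_dist G v (f u) = enat m"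
      using f(1) u tree(2) unfolding isometric_embedding_def v_def by blast
    have "graph_dist G w (f u) = enat (Suc m)"
    proof (rule graph_dist_extend[OF vV(2) vw m(3), where m = "n - 1"])
      \<comment> \<open>The strict bounds \<open>m < card S\<close> and \<open>card S < n\<close>
        leave room for the extra edge from \<open>v\<close> to \<open>w\<close>.\<close>
      show "m < n - 1"
        using m(1) tree(4) by simp
      show "f u = v \<or> w \<notin> short_starts (parcs G) (n - 1) v (f u)"
        using w(3) u by (auto simp: B_def)
    qed
    moreover have "(y, u) \<in> ?R' ^^ Suc m"
      using yx m(2) RR' by (intro relpow_Suc_I2) auto
    moreover from this have "(u, y) \<in> ?R' ^^ Suc m"
      by (rule relpow_sym[OF symR'])
    ultimately show ?thesis
      using m(1) graph_dist_commute[of "f u" w] by (intro exI[of _ "Suc m"]) (simp del: relpow.simps)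
  qed
  have self: "graph_dist G w w = enat 0"
  proof -
    have "graph_dist G w w \<le> enat 0"
      using w(1) V by (intro graph_dist_le_if_relpow) auto
    then show ?thesis
      by (simp add: zero_enat_def[symmetric])
  qed
  have "isometric_embedding G P (insert y S) A' g"
    unfolding isometric_embedding_def card
  proof (intro conjI)
    show "inj_on g (insert y S)"
      using f(1) new tree(3) unfolding isometric_embedding_def by (auto simp: g_def inj_on_def)
    have "(g a, g b) \<in> P" if "(a, b) \<in> A" for a b
    proof -
      have "a \<in> S" "b \<in> S"
        using that otree_arcs[OF tree(1)] by auto
      then show ?thesis
        using that f(1) gS unfolding isometric_embedding_def by auto
    qed
    then show "\<forall>(a, b)\<in>A'. (g a, g b) \<in> P"
      using A' w(2) gS[OF tree(2)] gy by (auto simp: v_def)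
    show "\<forall>a\<in>insert y S. \<forall>b\<in>insert y S.
        \<exists>m<Suc (card S). (a, b) \<in> ?R' ^^ m \<and> graph_dist G (g a) (g b) = enat m"
    proof (intro ballI)
      fix a b assume ab: "a \<in> insert y S" "b \<in> insert y S"
      consider "a \<in> S" "b \<in> S" | "a = y" "b \<in> S" | "a \<in> S" "b = y" | "a = y" "b = y"
        using ab by auto
      then show "\<exists>m<Suc (card S). (a, b) \<in> ?R' ^^ m \<and> graph_dist G (g a) (g b) = enat m"
      proof cases
        case 1
        then obtain m where "m < card S" "(a, b) \<in> ?R ^^ m" "graph_dist G (f a) (f b) = enat m"
          using f(1) unfolding isometric_embedding_def by blast
        then show ?thesis
          using RR' gS 1 by (intro exI[of _ m]) auto
      next
        case 2
        then show ?thesis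
          using to_new[of b] gS gy by auto
      next
        case 3
        then show ?thesis
          using to_new[of a] gS gy by auto
      next
        case 4
        then show ?thesis
          using self gy by (intro exI[of _ 0]) auto
      qed
    qed
  qed
  moreover have "g ` insert y S \<subseteq> V"
    using f(2) w(1) gS gy by auto
  ultimately show ?thesis
    by blast
qed

text \<open>
  Every vertex of too small degree is discarded before the rest of the tree is embedded, so the
  neighbour of the new leaf still has many candidates left; by the density assumption the discarded
  set is small.
\<close>
lemma (in pair_graph) ex_isometric_embedding:
  fixes k n :: nat and loss :: "nat \<Rightarrow> real"
  assumes tree: "otree S A" and "card S \<le> n"
    and orient: "P \<union> P\<inverse> = parcs G"
    and V: "V \<subseteq> pverts G"
    and few: "\<And>v u. v \<in> V \<Longrightarrow> u \<in> V \<Longrightarrow> u \<noteq> v \<Longrightarrow> card (short_starts (parcs G) (n - 1) v u) \<le> k"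
    and dense: "\<And>P X j. P \<union> P\<inverse> = parcs G \<Longrightarrow> X \<subseteq> pverts G \<Longrightarrow> 1 \<le> j \<Longrightarrow> j < n \<Longrightarrow>
        card (P \<inter> X \<times> X) \<le> j * k * card X \<Longrightarrow> real (card X) \<le> loss j"
    and big: "(\<Sum>j\<in>{1..<card S}. loss j) < card V"
  shows "\<exists>f. isometric_embedding G P S A f \<and> f ` S \<subseteq> V"
proof -
  \<comment> \<open>Both rules of \<open>otree\<close> share this step: with \<open>Q = P\<close>
    the new arc leaves \<open>x\<close>, with \<open>Q\<close> the converse of \<open>P\<close> it
    enters \<open>x\<close>.\<close>
  have step: "\<exists>g. isometric_embedding G P (insert y S) A' g \<and> g ` insert y S \<subseteq> V"
    if S: "otree S A" "x \<in> S" "y \<notin> S" and n: "card (insert y S) \<le> n" and V: "V \<subseteq> pverts G"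
    and few: "\<And>v u. v \<in> V \<Longrightarrow> u \<in> V \<Longrightarrow> u \<noteq> v \<Longrightarrow> card (short_starts (parcs G) (n - 1) v u) \<le> k"
    and big: "(\<Sum>j\<in>{1..<card (insert y S)}. loss j) < card V"
    and IH: "\<And>V'. V' \<subseteq> V \<Longrightarrow> (\<Sum>j\<in>{1..<card S}. loss j) < card V' \<Longrightarrow>
      \<exists>f. isometric_embedding G P S A f \<and> f ` S \<subseteq> V'"
    and A': "A' = insert (x, y) A \<and> Q = P \<or> A' = insert (y, x) A \<and> Q = P\<inverse>"
    for S :: "'b set" and A A' x y V Q
  proof -
    have fin: "finite S" "finite V"
      using otree_finite[OF S(1)] V pair_finite_verts by (auto intro: finite_subset)
    have card: "card (insert y S) = Suc (card S)" "1 \<le> card S"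
      using fin(1) S by (auto simp: Suc_le_eq card_gt_0_iff)
    \<comment> \<open>Degrees are counted in \<open>V\<close>, not in \<open>V - X\<close>: the
      image of \<open>x\<close> has to avoid \<open>X\<close>, while the new leaf may lie in
      it.\<close>
    define X where "X = {v \<in> V. card {w \<in> V. (v, w) \<in> Q} \<le> card S * k}"
    have X: "X \<subseteq> V" "finite X"
      using fin(2) by (auto simp: X_def)
    have "real (card X) \<le> loss (card S)"
    proof (rule dense[of Q])
      show "Q \<union> Q\<inverse> = parcs G"
        using A' orient by auto
      show "card (Q \<inter> X \<times> X) \<le> card S * k * card X"
        using X fin(2) by (intro card_low_degree_arcs[where V = V]) (auto simp: X_def)
    qed (use X V card n in auto)
    moreover have "real (card (V - X)) = card V - card X"
      using X by (simp add: card_Diff_subset card_mono fin(2) of_nat_diff)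
    ultimately have "(\<Sum>j\<in>{1..<card S}. loss j) < card (V - X)"
      using big card by simp
    then obtain f where f: "isometric_embedding G P S A f" "f ` S \<subseteq> V - X"
      using IH[of "V - X"] by auto
    show ?thesis
    proof (rule isometric_embedding_extend[OF S _ orient f(1) _ V few])
      show "card S * k < card {w \<in> V. (f x, w) \<in> Q}"
        using f(2) S(2) by (force simp: X_def)
      show "Q \<subseteq> parcs G"
        using A' orient by auto
    qed (use A' f(2) n card in auto)
  qed
  show ?thesis
    using tree assms(2) V few big
  proof (induction S A arbitrary: V rule: otree.induct)
    case (single x)
    then obtain v where v: "v \<in> V"
      by fastforce
    then have "graph_dist G v v \<le> enat 0"
      using single by (intro graph_dist_le_if_relpow) auto
    with v show ?case
      unfolding isometric_embedding_def
      by (intro exI[of _ "\<lambda>_. v"]) (auto simp: zero_enat_def[symmetric])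
  next
    case (out S A x y)
    have "card S \<le> n"
      using out.prems(1) out.hyps otree_finite[OF out.hyps(1)] by simp
    have Q: "insert (x, y) A = insert (x, y) A \<and> P = P \<or> insert (x, y) A = insert (y, x) A \<and> P = P\<inverse>"
      by simp
    show ?case
    proof (rule step[OF out.hyps(1-3) out.prems _ Q])
      show "\<exists>f. isometric_embedding G P S A f \<and> f ` S \<subseteq> V'"
        if "V' \<subseteq> V" "(\<Sum>j\<in>{1..<card S}. loss j) < card V'" for V'
        using that out.prems(2) \<open>card S \<le> n\<close> by (intro out.IH out.prems(3)) auto
    qed
  next
    case (inward S A x y)
    have "card S \<le> n"
      using inward.prems(1) inward.hyps otree_finite[OF inward.hyps(1)] by simp
    have Q: "insert (y, x) A = insert (x, y) A \<and> P\<inverse> = P \<or> insert (y, x) A = insert (y, x) A \<and> P\<inverse> = P\<inverse>"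
      by simp
    show ?case
    proof (rule step[OF inward.hyps(1-3) inward.prems _ Q])
      show "\<exists>f. isometric_embedding G P S A f \<and> f ` S \<subseteq> V'"
        if "V' \<subseteq> V" "(\<Sum>j\<in>{1..<card S}. loss j) < card V'" for V'
        using that inward.prems(2) \<open>card S \<le> n\<close> by (intro inward.IH inward.prems(3)) auto
    qed
  qed
qed

section \<open>Oriented trees grow leaf by leaf\<close>

lemma otree_connected:
  assumes "otree S A" "a \<in> S" "b \<in> S"
  shows "(a, b) \<in> (A \<union> A\<inverse>)\<^sup>*"
  using assms
proof (induction arbitrary: a b rule: otree.induct)
  case (single x)
  then show ?case by simp
next
  case (out S A x y)
  let ?R = "insert (x, y) A \<union> (insert (x, y) A)\<inverse>"
  have "(A \<union> A\<inverse>)\<^sup>* \<subseteq> ?R\<^sup>*"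
    by (intro rtrancl_mono) auto
  then have old: "(c, d) \<in> ?R\<^sup>*" if "c \<in> S" "d \<in> S" for c d
    using out.IH that by blast
  have "(x, y) \<in> ?R" "(y, x) \<in> ?R"
    by auto
  then have "(c, y) \<in> ?R\<^sup>*" "(y, c) \<in> ?R\<^sup>*" if "c \<in> S" for c
    using old[OF that \<open>x \<in> S\<close>] old[OF \<open>x \<in> S\<close> that]
    by (auto intro: rtrancl_into_rtrancl converse_rtrancl_into_rtrancl)
  with old show ?case
    using out.prems by blast
next
  case (inward S A x y)
  let ?R = "insert (y, x) A \<union> (insert (y, x) A)\<inverse>"
  have "(A \<union> A\<inverse>)\<^sup>* \<subseteq> ?R\<^sup>*"
    by (intro rtrancl_mono) auto
  then have old: "(c, d) \<in> ?R\<^sup>*" if "c \<in> S" "d \<in> S" for c d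
    using inward.IH that by blast
  have "(x, y) \<in> ?R" "(y, x) \<in> ?R"
    by auto
  then have "(c, y) \<in> ?R\<^sup>*" "(y, c) \<in> ?R\<^sup>*" if "c \<in> S" for c
    using old[OF that \<open>x \<in> S\<close>] old[OF \<open>x \<in> S\<close> that]
    by (auto intro: rtrancl_into_rtrancl converse_rtrancl_into_rtrancl)
  with old show ?case
    using inward.prems by blast
qed

text \<open>Two different neighbours of \<open>y\<close> in \<open>S\<close> would be joined by a
  path inside \<open>S\<close>, and closing it through \<open>y\<close> gives a cycle with at least
  three edges.\<close>

lemma (in pair_graph) acyclic_neighbour_unique:
  assumes acyclic: "\<not> (\<exists>p. cycle p \<and> 3 \<le> length p)"
    and S: "S \<subseteq> pverts G" "R \<subseteq> parcs G" "R \<subseteq> S \<times> S"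
    and conn: "(x, x') \<in> R\<^sup>*" and x: "x \<in> S" "x' \<in> S" and y: "y \<notin> S" "(y, x) \<in> parcs G" "(x', y) \<in> parcs G"
  shows "x = x'"
proof (rule ccontr)
  assume "x \<noteq> x'"
  \<comment> \<open>The walk is reduced to a simple path within \<open>H\<close>, whose vertex set
    is \<open>S\<close>, so that the path cannot pass through \<open>y\<close>.\<close>
  define H where "H = \<lparr>pverts = S, parcs = R\<rparr>"
  interpret H: pair_wf_digraph H
    using S(3) by unfold_locales (auto simp: H_def)
  obtain m where "(x, x') \<in> R ^^ m"
    using conn rtrancl_imp_relpow by blast
  then obtain p where "H.awalk x p x'"
    using H.awalk_of_relpow[of x x' m] x(1) by (auto simp: H_def)
  then obtain q where q: "H.apath x q x'"
    using H.apath_awalk_to_apath by blast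
  then have w: "H.awalk x q x'" and dist: "distinct (pawalk_verts x q)"
    by (auto simp: H.apath_def)
  have "q \<noteq> []"
    using w \<open>x \<noteq> x'\<close> H.awalk_Nil_iff[of x x'] by metis
  have "x \<in> pverts H" "set q \<subseteq> parcs H" "pcas x q x'"
    using w by (simp_all add: H.awalk_def)
  moreover from this have "set (pawalk_verts x q) \<subseteq> pverts H"
    using H.awalk_verts_in_verts[of x q] by blast
  ultimately have inS: "set (pawalk_verts x q) \<subseteq> S" and wG: "awalk x q x'"
    using S x unfolding awalk_def by (auto simp: H_def)
  then have w': "awalk x (q @ [(x', y), (y, x)]) x"
    using y by (auto simp: awalk_Cons_iff awalk_Nil_iff dest: in_arcsD2)
  moreover have "pawalk_verts x (q @ [(x', y), (y, x)]) = pawalk_verts x q @ [y, x]"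
    using awalk_verts_append[OF w'] by simp
  moreover have "x \<notin> set (tl (pawalk_verts x q))" "distinct (tl (pawalk_verts x q))"
    using dist w by (cases q; auto simp: H.awalk_Cons_iff)+
  moreover have "y \<notin> set (tl (pawalk_verts x q))" "y \<noteq> x"
    using inS y x by (auto dest: list.set_sel(2)[rotated])
  ultimately have "cycle (q @ [(x', y), (y, x)])"
    unfolding cycle_def by (intro exI[of _ x]) auto
  moreover have "3 \<le> length (q @ [(x', y), (y, x)])"
    using \<open>q \<noteq> []\<close> by (cases q) auto
  ultimately show False
    using acyclic by blast
qed

lemma rtrancl_leaves:
  assumes "(a, b) \<in> R\<^sup>*" "a \<in> S" "b \<notin> S"
  shows "\<exists>x\<in>S. \<exists>y. y \<notin> S \<and> (x, y) \<in> R"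
  using assms by (induction rule: rtrancl_induct) auto

lemma connected_leaves:
  assumes "pair_graph T" "connected (with_proj T)" "S \<subseteq> pverts T" "S \<noteq> {}" "S \<noteq> pverts T"
  shows "\<exists>x\<in>S. \<exists>y\<in>pverts T - S. (x, y) \<in> parcs T"
proof -
  interpret pair_graph T by fact
  have eq: "parcs (mk_symmetric (with_proj T)) = parcs T"
    using adj_mk_symmetric_eq[OF pair_sym_arcs] by simp
  obtain a b where "a \<in> S" "b \<in> pverts T" "b \<notin> S"
    using assms by auto
  moreover from this have "(a, b) \<in> (parcs T)\<^sup>*"
    using assms(2,3) unfolding connected_def strongly_connected_def reachable_def
    by (auto simp: eq dest: rtrancl_on_rtranclI)
  ultimately show ?thesis
    using rtrancl_leaves[of a b "parcs T" S] in_arcsD2 by blast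
qed

text \<open>A vertex set is grown inside the tree. Connectedness yields an edge from
  \<open>S\<close> to some \<open>y\<close> outside, acyclicity makes it the only edge between
  \<open>y\<close> and \<open>S\<close>, and its orientation selects the rule of
  \<open>otree\<close>.\<close>

lemma otree_if_oriented_tree:
  assumes T: "undirected_tree T" and D: "orientation_of D T"
  shows "otree (pverts D) (parcs D)"
proof -
  interpret pair_graph T
    using T by (simp add: undirected_tree_def)
  interpret D: pair_digraph D
    using orientation_of_pair_digraph(1)[OF pair_graph D] .
  have verts: "pverts D = pverts T" and sub: "parcs D \<subseteq> parcs T"
    using D by (auto simp: orientation_of_def)
  have conn: "connected (with_proj T)" and acyclic: "\<not> (\<exists>p. cycle p \<and> 3 \<le> length p)"
    using T by (auto simp: undirected_tree_def)
  have or: "(x, y) \<in> parcs D \<longleftrightarrow> (y, x) \<notin> parcs D" if "(x, y) \<in> parcs T" for x y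
    using D that by (auto simp: orientation_of_def)
  have "\<exists>S\<subseteq>pverts T. card S = Suc j \<and> otree S (parcs D \<inter> S \<times> S)" if "Suc j \<le> card (pverts T)" for j
    using that
  proof (induction j)
    case 0
    then obtain x where "x \<in> pverts T"
      by fastforce
    moreover have "parcs D \<inter> {x} \<times> {x} = {}"
      using D.no_loops' by auto
    ultimately show ?case
      using otree.single[of x] by (intro exI[of _ "{x}"]) auto
  next
    case (Suc j)
    then obtain S where S: "S \<subseteq> pverts T" "card S = Suc j" "otree S (parcs D \<inter> S \<times> S)"
      by auto
    then have "S \<noteq> {}" "S \<noteq> pverts T" "finite S"
      using Suc.prems pair_finite_verts by (auto intro: finite_subset)
    then obtain x y where xy: "x \<in> S" "y \<in> pverts T" "y \<notin> S" "(x, y) \<in> parcs T"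
      using connected_leaves[OF pair_graph conn S(1)] by auto
    define R where "R = (parcs D \<inter> S \<times> S) \<union> (parcs D \<inter> S \<times> S)\<inverse>"
    have R: "R \<subseteq> parcs T" "R \<subseteq> S \<times> S"
      unfolding R_def using sub arcs_symmetric by auto
    have uniq: "x' = x" if "x' \<in> S" "(x', y) \<in> parcs T \<or> (y, x') \<in> parcs T" for x'
    proof -
      have "(x, x') \<in> R\<^sup>*"
        using otree_connected[OF S(3) xy(1) that(1)] by (simp add: R_def)
      moreover have "(x', y) \<in> parcs T"
        using that(2) arcs_symmetric by blast
      ultimately show ?thesis
        using acyclic_neighbour_unique[OF acyclic S(1) R _ xy(1) that(1) xy(3) arcs_symmetric[OF xy(4)]]
        by simp
    qed
    let ?S = "insert y S"
    have noloop: "(y, y) \<notin> parcs D"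
      using D.no_loops'[of y y] by blast
    have new: "x' = x" if "x' \<in> S" "(x', y) \<in> parcs D \<or> (y, x') \<in> parcs D" for x'
      using uniq that sub by blast
    have or': "(x, y) \<in> parcs D \<longleftrightarrow> (y, x) \<notin> parcs D"
      using or[OF xy(4)] .
    have "otree ?S (parcs D \<inter> ?S \<times> ?S)"
    proof (cases "(x, y) \<in> parcs D")
      case True
      then have "parcs D \<inter> ?S \<times> ?S = insert (x, y) (parcs D \<inter> S \<times> S)"
        using new xy(1) noloop or' by blast
      then show ?thesis
        using otree.out[OF S(3) xy(1,3)] by simp
    next
      case False
      then have "parcs D \<inter> ?S \<times> ?S = insert (y, x) (parcs D \<inter> S \<times> S)"
        using new xy(1) noloop or' by blast
      then show ?thesis
        using otree.inward[OF S(3) xy(1,3)] by simp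
    qed
    then show ?case
      using S xy \<open>finite S\<close> by (intro exI[of _ ?S]) auto
  qed
  moreover have "pverts T \<noteq> {}"
    using conn by (simp add: connected_def strongly_connected_def)
  then obtain j where "card (pverts T) = Suc j"
    using pair_finite_verts by (metis card_eq_0_iff not0_implies_Suc)
  ultimately obtain S where "S \<subseteq> pverts T" "card S = card (pverts T)" "otree S (parcs D \<inter> S \<times> S)"
    by force
  moreover from this have "S = pverts T"
    using pair_finite_verts card_subset_eq by blast
  moreover have "parcs D \<inter> pverts T \<times> pverts T = parcs D"
    using sub in_arcsD1 in_arcsD2 by auto
  ultimately show ?thesis
    using verts by simp
qed

section \<open>From embeddings to the arrow relation\<close>

lemma relpow_image:
  assumes "\<And>a b. (a, b) \<in> R \<Longrightarrow> (f a, f b) \<in> R'" "(u, v) \<in> R ^^ m"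
  shows "(f u, f v) \<in> R' ^^ m"
  using assms(2)
proof (induction m arbitrary: v)
  case (Suc m)
  then obtain w where w: "(u, w) \<in> R ^^ m" "(w, v) \<in> R"
    by auto
  then show ?case
    using Suc.IH[OF w(1)] assms(1)[OF w(2)] by (rule_tac relpow_Suc_I)
qed auto

text \<open>The assumptions isolate what the random graph must supply: a set \<open>V\<close> in
  which short starts are few, and a density that holds for every orientation and limits the total
  loss.\<close>

lemma (in pair_graph) arrows_oriented_tree:
  fixes k n :: nat and loss :: "nat \<Rightarrow> real"
  assumes V: "V \<subseteq> pverts G"
    and few: "\<And>v u. v \<in> V \<Longrightarrow> u \<in> V \<Longrightarrow> u \<noteq> v \<Longrightarrow> card (short_starts (parcs G) (n - 1) v u) \<le> k"
    and dense: "\<And>P X j. P \<union> P\<inverse> = parcs G \<Longrightarrow> X \<subseteq> pverts G \<Longrightarrow> 1 \<le> j \<Longrightarrow> j < n \<Longrightarrow>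
        card (P \<inter> X \<times> X) \<le> j * k * card X \<Longrightarrow> real (card X) \<le> loss j"
    and big: "(\<Sum>j\<in>{1..<n}. loss j) < card V"
    and H: "H \<in> oriented_trees n"
  shows "arrows G H"
  unfolding arrows_def
proof (intro allI impI)
  fix D assume D: "orientation_of D G"
  obtain T where T: "undirected_tree T" "card (pverts T) = n" "orientation_of H T"
    using H by (auto simp: oriented_trees_def)
  interpret T: pair_graph T
    using T(1) by (simp add: undirected_tree_def)
  have verts: "pverts H = pverts T"
    using T(3) by (simp add: orientation_of_def)
  have tree: "otree (pverts H) (parcs H)" and card: "card (pverts H) = n"
    using otree_if_oriented_tree[OF T(1,3)] T(2) verts by simp_all
  have orient: "parcs D \<union> (parcs D)\<inverse> = parcs G"
    using D arcs_symmetric unfolding orientation_of_def by fast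
  have asym: "asym (parcs D)"
    using orientation_of_pair_digraph(2)[OF pair_graph D] .
  have "\<exists>f. isometric_embedding G (parcs D) (pverts H) (parcs H) f \<and> f ` pverts H \<subseteq> V"
  proof (rule ex_isometric_embedding[OF tree _ orient V])
    show "card (short_starts (parcs G) (n - 1) v u) \<le> k" if "v \<in> V" "u \<in> V" "u \<noteq> v" for v u
      using that by (rule few)
    show "real (card X) \<le> loss j"
      if "P \<union> P\<inverse> = parcs G" "X \<subseteq> pverts G" "1 \<le> j" "j < n" "card (P \<inter> X \<times> X) \<le> j * k * card X"
      for P X j
      using that by (rule dense)
  qed (use big card in simp_all)
  then obtain f where "isometric_embedding G (parcs D) (pverts H) (parcs H) f" "f ` pverts H \<subseteq> V"
    by blast
  then have f: "f ` pverts H \<subseteq> pverts G" "inj_on f (pverts H)"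
      "\<And>x y. (x, y) \<in> parcs H \<Longrightarrow> (f x, f y) \<in> parcs D"
    and dist: "\<And>x y. x \<in> pverts H \<Longrightarrow> y \<in> pverts H \<Longrightarrow>
      \<exists>m. (x, y) \<in> (parcs H \<union> (parcs H)\<inverse>) ^^ m \<and> graph_dist G (f x) (f y) = enat m"
    using V unfolding isometric_embedding_def by blast+
  have und: "mk_symmetric (with_proj H) = T"
    using orientation_of_underlying[OF T.pair_graph T(3)] .
  have parcsT: "parcs T = parcs H \<union> (parcs H)\<inverse>"
    unfolding und[symmetric] parcs_mk_symmetric by auto
  have hom: "(f x, f y) \<in> parcs G" if "(x, y) \<in> parcs T" for x y
    using that f(3) orient unfolding parcsT by blast
  \<comment> \<open>The tree has a walk of length \<open>m\<close>, so its distance is at most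
    \<open>m\<close>; conversely a shortest tree path is mapped to a walk in \<open>G\<close>, so
    \<open>m\<close> is at most the tree distance.\<close>
  have iso: "digraph_dist H u v = graph_dist G (f u) (f v)" if uv: "u \<in> pverts H" "v \<in> pverts H" for u v
  proof -
    obtain m where m: "(u, v) \<in> parcs T ^^ m" "graph_dist G (f u) (f v) = enat m"
      using dist[OF uv] unfolding parcsT by blast
    have le: "graph_dist T u v \<le> enat m"
      using m(1) uv verts by (intro T.graph_dist_le_if_relpow) auto
    then obtain l where l: "graph_dist T u v = enat l"
      by (cases "graph_dist T u v") auto
    then obtain xs where xs: "successively (\<lambda>a b. (a, b) \<in> parcs T) (u # xs)" "last (u # xs) = v" "length xs \<le> l"
      using T.graph_dist_leE[of u v l] by auto
    have "(f u, f v) \<in> parcs G ^^ length xs"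
      using relpow_image[OF hom relpow_if_successively[OF xs(1)]] xs(2) by simp
    then have "graph_dist G (f u) (f v) \<le> enat (length xs)"
      using f(1) uv by (intro graph_dist_le_if_relpow) auto
    with m(2) le l xs(3) show ?thesis
      unfolding digraph_dist_def und by simp
  qed
  \<comment> \<open>Adjacent images have distance at most 1, so the witness \<open>m\<close> is 0 or
    1. The value 0 would force \<open>u = v\<close>; for 1, asymmetry of \<open>D\<close> fixes the
    direction of the arc.\<close>
  have "(u, v) \<in> parcs H \<longleftrightarrow> (f u, f v) \<in> parcs D" if uv: "u \<in> pverts H" "v \<in> pverts H" for u v
  proof
    assume fuv: "(f u, f v) \<in> parcs D"
    then have "f u \<noteq> f v" "(f u, f v) \<in> parcs G"
      using asym orient by (auto dest: asymD)
    then have "graph_dist G (f u) (f v) \<le> enat 1"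
      using f(1) uv by (intro graph_dist_le_if_relpow) auto
    moreover obtain m where m: "(u, v) \<in> (parcs H \<union> (parcs H)\<inverse>) ^^ m" "graph_dist G (f u) (f v) = enat m"
      using dist[OF uv] by blast
    ultimately consider "m = 0" | "m = 1"
      by force
    then show "(u, v) \<in> parcs H"
    proof cases
      case 1
      then show ?thesis
        using m(1) \<open>f u \<noteq> f v\<close> by simp
    next
      case 2
      then have "(u, v) \<in> parcs H \<or> (v, u) \<in> parcs H"
        using m(1) by simp
      then show ?thesis
        using f(3) fuv asym by (auto dest: asymD)
    qed
  qed (rule f(3))
  with f iso show "\<exists>f. f ` pverts H \<subseteq> pverts G \<and> inj_on f (pverts H) \<and>
      (\<forall>u\<in>pverts H. \<forall>v\<in>pverts H. ((u, v) \<in> parcs H) = ((f u, f v) \<in> parcs D)) \<and>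
      (\<forall>u\<in>pverts H. \<forall>v\<in>pverts H. digraph_dist H u v = graph_dist G (f u) (f v))"
    by (intro exI[of _ f]) auto
qed

section \<open>Random graphs\<close>

text \<open>For \<open>S\<close> contained in \<open>E\<close>, this is the probability that a
  random subset of \<open>E\<close>, each element chosen independently with probability
  \<open>p\<close>, equals \<open>S\<close>. Expectations are finite sums with these
  weights.\<close>

definition bernoulli_weight :: "real \<Rightarrow> 'a set \<Rightarrow> 'a set \<Rightarrow> real" where
  "bernoulli_weight p E S = p ^ card S * (1 - p) ^ card (E - S)"

lemma bernoulli_weight_nonneg: "0 \<le> p \<Longrightarrow> p \<le> 1 \<Longrightarrow> 0 \<le> bernoulli_weight p E S"
  by (simp add: bernoulli_weight_def)

text \<open>The left side is the expansion of a product over \<open>E\<close> whose factors are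
  \<open>p * z + (1 - p)\<close> on \<open>A\<close> and 1 elsewhere.\<close>

lemma bernoulli_generating:
  assumes "finite E" "A \<subseteq> E"
  shows "(\<Sum>S\<in>Pow E. bernoulli_weight p E S * z ^ card (S \<inter> A)) = (1 - p + p * z) ^ card A"
proof -
  let ?g = "\<lambda>e. if e \<in> A then z else 1"
  have "(\<Prod>e\<in>E. p * ?g e + (1 - p)) = (\<Sum>S\<in>Pow E. (\<Prod>e\<in>S. p * ?g e) * (\<Prod>e\<in>E - S. 1 - p))"
    by (rule prod_add[OF assms(1)])
  also have "\<dots> = (\<Sum>S\<in>Pow E. bernoulli_weight p E S * z ^ card (S \<inter> A))"
  proof (rule sum.cong)
    fix S assume "S \<in> Pow E"
    then have "finite S"
      using assms(1) finite_subset by blast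
    then have "(\<Prod>e\<in>S. ?g e) = z ^ card (S \<inter> A)"
      by (simp add: prod.If_cases)
    then show "(\<Prod>e\<in>S. p * ?g e) * (\<Prod>e\<in>E - S. 1 - p) = bernoulli_weight p E S * z ^ card (S \<inter> A)"
      unfolding bernoulli_weight_def by (simp add: prod.distrib)
  qed simp
  also have "(\<Prod>e\<in>E. p * ?g e + (1 - p)) = (\<Prod>e\<in>E. if e \<in> A then 1 - p + p * z else 1)"
    by (rule prod.cong) auto
  also have "\<dots> = (1 - p + p * z) ^ card (E \<inter> A)"
    using assms(1) by (simp add: prod.If_cases)
  finally show ?thesis
    using assms(2) by (simp add: Int_absorb1)
qed

lemma bernoulli_total: "finite E \<Longrightarrow> (\<Sum>S\<in>Pow E. bernoulli_weight p E S) = 1"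
  using bernoulli_generating[of E "{}" p 1] by simp

text \<open>The same expansion, with the summand \<open>1 - p\<close> replaced by 0 on
  \<open>F\<close>: this kills exactly the terms of sets that miss an element of
  \<open>F\<close>.\<close>

lemma bernoulli_superset:
  assumes "finite E" "F \<subseteq> E"
  shows "(\<Sum>S\<in>Pow E. bernoulli_weight p E S * of_bool (F \<subseteq> S)) = p ^ card F"
proof -
  let ?g = "\<lambda>e. if e \<in> F then 0 else 1 - p"
  have "(\<Prod>e\<in>E. p + ?g e) = (\<Sum>S\<in>Pow E. (\<Prod>e\<in>S. p) * (\<Prod>e\<in>E - S. ?g e))"
    by (rule prod_add[OF assms(1)])
  also have "\<dots> = (\<Sum>S\<in>Pow E. bernoulli_weight p E S * of_bool (F \<subseteq> S))"
  proof (rule sum.cong)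
    fix S assume S: "S \<in> Pow E"
    have "(\<Prod>e\<in>E - S. ?g e) = of_bool (F \<subseteq> S) * (1 - p) ^ card (E - S)"
    proof (cases "F \<subseteq> S")
      case True
      then have "(\<Prod>e\<in>E - S. ?g e) = (\<Prod>e\<in>E - S. 1 - p)"
        by (intro prod.cong) auto
      with True show ?thesis by simp
    next
      case False
      then show ?thesis
        using assms by (auto intro!: prod_zero)
    qed
    then show "(\<Prod>e\<in>S. p) * (\<Prod>e\<in>E - S. ?g e) = bernoulli_weight p E S * of_bool (F \<subseteq> S)"
      unfolding bernoulli_weight_def by simp
  qed simp
  also have "(\<Prod>e\<in>E. p + ?g e) = (\<Prod>e\<in>E. if e \<in> F then p else 1)"
    by (rule prod.cong) auto
  also have "\<dots> = p ^ card (E \<inter> F)"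
    using assms(1) by (simp add: prod.If_cases)
  finally show ?thesis
    using assms(2) by (simp add: Int_absorb1)
qed

text \<open>Chernoff's method with \<open>z = exp (- 1/4)\<close>. Since \<open>z\<close> is at most
  4/5, each element of \<open>A\<close> contributes at most \<open>exp (- p / 5)\<close>, against a
  factor \<open>exp (3/16 * p)\<close> from the threshold; 3/16 - 1/5 = -1/80.\<close>

lemma bernoulli_lower_tail:
  fixes p :: real
  assumes "finite E" "A \<subseteq> E" "0 \<le> p" "p \<le> 1"
  shows "(\<Sum>S\<in>Pow E. bernoulli_weight p E S * of_bool (card (S \<inter> A) \<le> 3/4 * p * card A))
    \<le> exp (- p * card A / 80)"
proof -
  define z :: real where "z = exp (- 1/4)"
  define m where "m = card A"
  have "5/4 \<le> exp (1/4 :: real)"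
    using exp_ge_add_one_self[of "1/4 :: real"] by simp
  then have z: "0 < z" "z \<le> 4/5"
    by (auto simp: z_def exp_minus field_simps)
  have "(\<Sum>S\<in>Pow E. bernoulli_weight p E S * of_bool (card (S \<inter> A) \<le> 3/4 * p * m))
    \<le> (\<Sum>S\<in>Pow E. bernoulli_weight p E S * (exp (3/16 * p * m) * z ^ card (S \<inter> A)))"
  proof (intro sum_mono mult_left_mono bernoulli_weight_nonneg assms)
    fix S
    have eq: "exp (3/16 * p * m) * z ^ card (S \<inter> A) = exp ((3/4 * p * m - card (S \<inter> A)) / 4)"
      unfolding z_def exp_of_nat_mult[symmetric] exp_add[symmetric] by (simp add: algebra_simps)
    show "of_bool (real (card (S \<inter> A)) \<le> 3/4 * p * m) \<le> exp (3/16 * p * m) * z ^ card (S \<inter> A)"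
      unfolding eq by (cases "real (card (S \<inter> A)) \<le> 3/4 * p * m") auto
  qed
  also have "\<dots> = exp (3/16 * p * m) * (\<Sum>S\<in>Pow E. bernoulli_weight p E S * z ^ card (S \<inter> A))"
    by (simp add: sum_distrib_left mult.left_commute)
  also have "\<dots> = exp (3/16 * p * m) * (1 - p + p * z) ^ m"
    using bernoulli_generating[OF assms(1,2)] by (simp add: m_def)
  also have "\<dots> \<le> exp (3/16 * p * m) * exp (- p / 5) ^ m"
  proof (intro mult_left_mono power_mono)
    have "p * z \<le> p * (4/5)"
      using assms z by (intro mult_left_mono) auto
    then have "1 - p + p * z \<le> 1 + (- p / 5)"
      by simp
    also have "\<dots> \<le> exp (- p / 5)"
      by (rule exp_ge_add_one_self)
    finally show "1 - p + p * z \<le> exp (- p / 5)" .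
  qed (use assms z in auto)
  also have "\<dots> = exp (- p * m / 80)"
    unfolding exp_of_nat_mult[symmetric] exp_add[symmetric] by (simp add: algebra_simps)
  finally show ?thesis
    by (simp add: m_def)
qed

lemma bernoulli_first_moment:
  assumes "finite E" "0 \<le> p" "p \<le> 1" "(\<Sum>S\<in>Pow E. bernoulli_weight p E S * Z S) < 1"
  obtains S where "S \<subseteq> E" "Z S < 1"
proof -
  have "\<exists>S\<in>Pow E. Z S < 1"
  proof (rule ccontr)
    assume "\<not> ?thesis"
    then have "(\<Sum>S\<in>Pow E. bernoulli_weight p E S * 1) \<le> (\<Sum>S\<in>Pow E. bernoulli_weight p E S * Z S)"
      by (intro sum_mono mult_left_mono bernoulli_weight_nonneg assms) (auto simp: not_less)
    then show False
      using bernoulli_total[OF assms(1)] assms(4) by simp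
  qed
  with that show ?thesis
    by auto
qed

section \<open>Paths, ears and their edges\<close>

fun path_edges :: "'a list \<Rightarrow> 'a set set" where
  "path_edges (x # y # xs) = insert {x, y} (path_edges (y # xs))"
| "path_edges _ = {}"

lemma path_edges_subset: "e \<in> path_edges xs \<Longrightarrow> e \<subseteq> set xs"
  by (induction xs rule: path_edges.induct) auto

lemma finite_path_edges: "finite (path_edges xs)"
  by (induction xs rule: path_edges.induct) auto

lemma card_path_edges: "distinct (x # xs) \<Longrightarrow> card (path_edges (x # xs)) = length xs"
proof (induction xs arbitrary: x)
  case (Cons y xs)
  moreover have "{x, y} \<notin> path_edges (y # xs)"
    using Cons.prems path_edges_subset[of "{x, y}" "y # xs"] by auto
  ultimately show ?case
    by (simp add: finite_path_edges)
qed simp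

lemma card_in_path_edges: "distinct xs \<Longrightarrow> e \<in> path_edges xs \<Longrightarrow> card e = 2"
  by (induction xs rule: path_edges.induct) auto

lemma path_edges_butlast: "e \<in> path_edges xs \<Longrightarrow> e \<inter> set (butlast xs) \<noteq> {}"
  by (induction xs rule: path_edges.induct) auto

lemma path_edges_if_successively:
  "successively (\<lambda>a b. {a, b} \<in> S) xs \<longleftrightarrow> path_edges xs \<subseteq> S"
  by (induction xs rule: path_edges.induct) auto

lemma set_path_edges: "set (x # xs) \<subseteq> insert x (\<Union>(path_edges (x # xs)))"
  by (induction xs arbitrary: x) auto

text \<open>
  A system of ears at \<open>v\<close>: each path \<open>v # q\<close> starts with a new edge at \<open>v\<close> and runs through new
  vertices until its last vertex, which lies on the previous ears. Thus the edges of different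
  ears are distinct.
\<close>
fun ear_verts :: "'a \<Rightarrow> 'a \<Rightarrow> 'a list list \<Rightarrow> 'a set" where
  "ear_verts v u [] = {v, u}"
| "ear_verts v u (q # qs) = set q \<union> ear_verts v u qs"

definition ear_edges :: "'a \<Rightarrow> 'a list list \<Rightarrow> 'a set set" where
  "ear_edges v qs = (\<Union>q\<in>set qs. path_edges (v # q))"

fun ear_system :: "'a set \<Rightarrow> nat \<Rightarrow> 'a \<Rightarrow> 'a \<Rightarrow> 'a list list \<Rightarrow> bool" where
  "ear_system V m v u [] \<longleftrightarrow> True"
| "ear_system V m v u (q # qs) \<longleftrightarrow>
     ear_system V m v u qs \<and> q \<noteq> [] \<and> length q \<le> m \<and> set q \<subseteq> V \<and> distinct (v # q) \<and>
     last q \<in> ear_verts v u qs \<and> set (butlast q) \<inter> ear_verts v u qs = {} \<and> hd q \<notin> hd ` set qs"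

lemma ear_edges_subset_verts: "e \<in> ear_edges v qs \<Longrightarrow> e \<subseteq> ear_verts v u qs"
proof (induction qs)
  case (Cons q qs)
  have "v \<in> ear_verts v u qs"
    by (induction qs) auto
  with Cons path_edges_subset[of e "v # q"] show ?case
    by (auto simp: ear_edges_def)
qed (simp add: ear_edges_def)

lemma ear_system_distinct: "ear_system V m v u qs \<Longrightarrow> q \<in> set qs \<Longrightarrow> q \<noteq> [] \<and> distinct (v # q) \<and> set q \<subseteq> V"
  by (induction qs) auto

text \<open>No ear returns to \<open>v\<close>, so the only edge of an ear that contains
  \<open>v\<close> is its first one.\<close>

lemma ear_edges_at_start:
  assumes "ear_system V m v u qs" "{v, x} \<in> ear_edges v qs"
  shows "x \<in> hd ` set qs"
proof -
  obtain q where q: "q \<in> set qs" "{v, x} \<in> path_edges (v # q)"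
    using assms(2) by (auto simp: ear_edges_def)
  with ear_system_distinct[OF assms(1)] have "q \<noteq> []" "v \<notin> set q"
    by auto
  then obtain y ys where y: "q = y # ys"
    by (cases q) auto
  have "{v, x} \<notin> path_edges q"
    using path_edges_subset[of "{v, x}" q] \<open>v \<notin> set q\<close> by auto
  then have "{v, x} = {v, y}"
    using q(2) y by auto
  then have "x = y"
    by (auto simp: doubleton_eq_iff)
  with q(1) y show ?thesis
    by force
qed

text \<open>A new ear shares no edge with earlier ones: its first edge has a new head, and every
  other edge contains an inner vertex, which is new. Hence the total length is the exponent of
  \<open>p\<close> in the probability that the system is present.\<close>

lemma card_ear_edges:
  "ear_system V m v u qs \<Longrightarrow> card (ear_edges v qs) = sum_list (map length qs)"
proof (induction qs)
  case (Cons q qs)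
  have "path_edges (v # q) \<inter> ear_edges v qs = {}"
  proof (rule ccontr)
    assume "\<not> ?thesis"
    then obtain e where e: "e \<in> path_edges (v # q)" "e \<in> ear_edges v qs"
      by blast
    obtain y ys where q: "q = y # ys"
      using Cons.prems by (cases q) auto
    then consider "e = {v, hd q}" | "e \<in> path_edges q"
      using e(1) by auto
    then show False
    proof cases
      case 1
      then show False
        using ear_edges_at_start[of V m v u qs "hd q"] e(2) Cons.prems by auto
    next
      case 2
      then show False
        using path_edges_butlast[OF 2] ear_edges_subset_verts[OF e(2), of u] Cons.prems by auto
    qed
  qed
  moreover have "ear_edges v (q # qs) = path_edges (v # q) \<union> ear_edges v qs"
    by (auto simp: ear_edges_def)
  moreover have "finite (ear_edges v qs)"
    by (auto simp: ear_edges_def finite_path_edges)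
  ultimately show ?case
    using Cons card_path_edges[of v q] by (simp add: card_Un_disjoint finite_path_edges)
qed (simp add: ear_edges_def)

lemma card_ear_verts:
  assumes "ear_system V m v u qs"
  shows "finite (ear_verts v u qs) \<and> card (ear_verts v u qs) \<le> 2 + length qs * m"
  using assms
proof (induction qs)
  case Nil
  show ?case by (simp add: card_insert_if)
next
  case (Cons q qs)
  have "card (set q \<union> ear_verts v u qs) \<le> card (set q) + card (ear_verts v u qs)"
    by (rule card_Un_le)
  also have "\<dots> \<le> m + (2 + length qs * m)"
    using Cons card_length[of q] by (intro add_mono) auto
  finally show ?case
    using Cons by simp
qed

lemma ex_ear_system:
  assumes V: "finite V" "S \<subseteq> {e. e \<subseteq> V \<and> card e = 2}" and uv: "u \<noteq> v"
    and "i \<le> card (short_starts {(a, b). {a, b} \<in> S} m v u)"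
  shows "\<exists>qs. ear_system V m v u qs \<and> length qs = i \<and> ear_edges v qs \<subseteq> S"
proof -
  define W where "W = short_starts {(a, b). {a, b} \<in> S} m v u"
  have "\<exists>qs. ear_system V m v u qs \<and> length qs = i \<and> ear_edges v qs \<subseteq> S \<and> hd ` set qs \<subseteq> W"
    if "i \<le> card W" for i
    using that
  proof (induction i)
    case 0
    show ?case by (intro exI[of _ "[]"]) (simp add: ear_edges_def)
  next
    case (Suc i)
    then obtain qs where qs: "ear_system V m v u qs" "length qs = i" "ear_edges v qs \<subseteq> S" "hd ` set qs \<subseteq> W"
      by auto
    have "card (hd ` set qs) < card W"
      using card_image_le[of "set qs" hd] card_length[of qs] qs(2) Suc.prems by simp
    then have "hd ` set qs \<noteq> W"
      by auto
    with qs(4) obtain w where w: "w \<in> W" "w \<notin> hd ` set qs"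
      by blast
    then obtain xs where xs: "distinct (v # w # xs)"
        "successively (\<lambda>a b. {a, b} \<in> S) (v # w # xs)" "last (w # xs) = u" "length (w # xs) \<le> m"
      unfolding W_def short_starts_def by auto
    have "u \<in> ear_verts v u qs"
      by (induction qs) auto
    moreover have "u \<in> set (w # xs)"
      using xs(3) last_in_set[of "w # xs"] by auto
    \<comment> \<open>The path is cut at its first vertex on the earlier ears. There is one because
      \<open>u\<close> counts as such from the outset; if \<open>w\<close> already is one, the ear
      is a single edge.\<close>
    ultimately obtain ys x zs where split: "w # xs = ys @ x # zs" "x \<in> ear_verts v u qs"
        "\<forall>y\<in>set ys. y \<notin> ear_verts v u qs"
      using split_list_first_prop[of "w # xs" "\<lambda>x. x \<in> ear_verts v u qs"] by blast
    define q where "q = ys @ [x]"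
    have wq: "w # xs = q @ zs"
      using split(1) by (simp add: q_def)
    have hd: "hd q = w"
      using wq by (simp add: q_def hd_append split: if_splits) (metis append_Nil hd_append list.sel(1) append_is_Nil_conv list.distinct(1))
    have "successively (\<lambda>a b. {a, b} \<in> S) ((v # q) @ zs)"
      using xs(2) wq by simp
    then have edges: "path_edges (v # q) \<subseteq> S"
      unfolding successively_append_iff by (simp add: path_edges_if_successively)
    have "distinct ((v # q) @ zs)"
      using xs(1) wq by simp
    then have dist: "distinct (v # q)"
      by auto
    have "set q \<subseteq> \<Union>(path_edges (v # q))"
      using set_path_edges[of v q] dist by auto
    then have "set q \<subseteq> V"
      using edges V(2) by auto
    moreover have "length q \<le> m"
      using xs(4) arg_cong[OF wq, of length] by simp
    ultimately have "ear_system V m v u (q # qs)"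
      using qs(1) split(2,3) dist hd w(2) by (auto simp: q_def)
    moreover have "ear_edges v (q # qs) \<subseteq> S"
      using qs(3) edges by (auto simp: ear_edges_def)
    ultimately show ?case
      using qs(2,4) hd w(1) by (intro exI[of _ "q # qs"]) auto
  qed
  then show ?thesis
    using assms(4) unfolding W_def by blast
qed

section \<open>Expected numbers of ears and ear systems\<close>

text \<open>An ear with \<open>l + 1\<close> edges is overcounted as \<open>l\<close> arbitrary
  vertices of \<open>V\<close> followed by an end in \<open>W\<close>.\<close>

lemma sum_ears_le:
  fixes p :: real and m :: nat
  assumes "finite V" "finite W" "0 \<le> p"
  defines "Q \<equiv> {q. q \<noteq> [] \<and> set q \<subseteq> V \<and> length q \<le> m \<and> last q \<in> W}"
  shows "finite Q \<and> (\<Sum>q\<in>Q. p ^ length q) \<le> card W * (\<Sum>l<m. card V ^ l * p ^ Suc l)"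
proof
  define I where "I = (SIGMA l:{..<m}. {ys. set ys \<subseteq> V \<and> length ys = l} \<times> W)"
  have fin: "finite I"
    unfolding I_def using assms(1,2) by (intro finite_SigmaI finite_cartesian_product finite_lists_length_eq) auto
  have sub: "Q \<subseteq> (\<lambda>(l, ys, x). ys @ [x]) ` I"
  proof
    fix q assume q: "q \<in> Q"
    then have "q = butlast q @ [last q]" "length (butlast q) < m" "set (butlast q) \<subseteq> V"
      unfolding Q_def by (auto dest: in_set_butlastD) (cases q; simp)+
    with q show "q \<in> (\<lambda>(l, ys, x). ys @ [x]) ` I"
      unfolding I_def Q_def by (intro image_eqI[of _ _ "(length (butlast q), butlast q, last q)"]) auto
  qed
  with fin show finQ: "finite Q"
    by (meson finite_imageI finite_subset)
  have "(\<Sum>q\<in>Q. p ^ length q) \<le> (\<Sum>q\<in>(\<lambda>(l, ys, x). ys @ [x]) ` I. p ^ length q)"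
    using sub fin assms(3) by (intro sum_mono2) auto
  also have "\<dots> \<le> (\<Sum>i\<in>I. p ^ length ((\<lambda>(l, ys, x). ys @ [x]) i))"
    using sum_image_le[OF fin, of "\<lambda>q. p ^ length q" "\<lambda>(l, ys, x). ys @ [x]"] assms(3)
    by (auto simp: o_def)
  also have "\<dots> = (\<Sum>i\<in>I. p ^ Suc (fst i))"
    by (intro sum.cong) (auto simp: I_def)
  also have "\<dots> = (\<Sum>l<m. \<Sum>_\<in>{ys. set ys \<subseteq> V \<and> length ys = l} \<times> W. p ^ Suc l)"
    unfolding I_def using assms(1,2)
    by (subst sum.Sigma) (auto intro!: finite_cartesian_product finite_lists_length_eq simp: case_prod_unfold)
  also have "\<dots> = card W * (\<Sum>l<m. card V ^ l * p ^ Suc l)"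
    using assms(1,2) by (simp add: card_cartesian_product card_lists_length_eq sum_distrib_left algebra_simps)
  finally show "(\<Sum>q\<in>Q. p ^ length q) \<le> card W * (\<Sum>l<m. card V ^ l * p ^ Suc l)" .
qed

text \<open>Each further ear costs a factor \<open>c\<close>, since it ends on one of the at most
  \<open>2 + k * m\<close> vertices of the at most \<open>k\<close> earlier ears.\<close>

lemma sum_ear_systems_le:
  fixes p c :: real and v u :: 'a
  assumes V: "finite V" and p: "0 \<le> p"
    and c: "real (2 + k * m) * (\<Sum>l<m. card V ^ l * p ^ Suc l) \<le> c" and "i \<le> Suc k"
  defines "Q \<equiv> \<lambda>i. {qs. ear_system V m v u qs \<and> length qs = i}"
  shows "finite (Q i) \<and> (\<Sum>qs\<in>Q i. p ^ sum_list (map length qs)) \<le> c ^ i"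
  using assms(4)
proof (induction i)
  case 0
  have "Q 0 = {[]}"
    by (auto simp: Q_def)
  then show ?case by simp
next
  case (Suc i)
  define w where "w = (\<Sum>l<m. card V ^ l * p ^ Suc l)"
  have w: "0 \<le> w"
    unfolding w_def using p by (intro sum_nonneg) auto
  define E where "E = (\<lambda>qs. {q. q \<noteq> [] \<and> set q \<subseteq> V \<and> length q \<le> m \<and> last q \<in> ear_verts v u qs})"
  have E: "finite (E qs) \<and> (\<Sum>q\<in>E qs. p ^ length q) \<le> c" if "qs \<in> Q i" for qs
  proof -
    have qs: "ear_system V m v u qs" "length qs = i"
      using that by (auto simp: Q_def)
    note verts = card_ear_verts[OF qs(1)]
    have fin: "finite (E qs)" and "(\<Sum>q\<in>E qs. p ^ length q) \<le> card (ear_verts v u qs) * w"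
      using sum_ears_le[OF V _ p, of "ear_verts v u qs" m] verts unfolding E_def w_def by auto
    note this(2)
    also have "card (ear_verts v u qs) * w \<le> real (2 + k * m) * w"
    proof (intro mult_right_mono w)
      have "card (ear_verts v u qs) \<le> 2 + i * m"
        using verts qs(2) by simp
      also have "\<dots> \<le> 2 + k * m"
        using Suc.prems by simp
      finally show "real (card (ear_verts v u qs)) \<le> real (2 + k * m)"
        by (simp only: of_nat_le_iff)
    qed
    also have "\<dots> \<le> c"
      using c by (simp add: w_def)
    finally show ?thesis
      using fin by simp
  qed
  have IH: "finite (Q i)" "(\<Sum>qs\<in>Q i. p ^ sum_list (map length qs)) \<le> c ^ i"
    using Suc by auto
  have "0 \<le> real (2 + k * m) * w"
    using w by simp
  then have "0 \<le> c"
    using c[folded w_def] by linarith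
  define P where "P = (SIGMA qs:Q i. E qs)"
  have finP: "finite P"
    unfolding P_def using IH(1) E by auto
  have sub: "Q (Suc i) \<subseteq> (\<lambda>(qs, q). q # qs) ` P"
  proof
    fix r assume "r \<in> Q (Suc i)"
    then obtain q qs where "r = q # qs" "length qs = i" "ear_system V m v u (q # qs)"
      by (cases r) (auto simp: Q_def)
    then show "r \<in> (\<lambda>(qs, q). q # qs) ` P"
      unfolding P_def Q_def E_def by (intro image_eqI[of _ _ "(qs, q)"]) auto
  qed
  have "(\<Sum>qs\<in>Q (Suc i). p ^ sum_list (map length qs))
      \<le> (\<Sum>qs\<in>(\<lambda>(qs, q). q # qs) ` P. p ^ sum_list (map length qs))"
    using sub finP p by (intro sum_mono2) auto
  also have "\<dots> = (\<Sum>(qs, q)\<in>P. p ^ sum_list (map length qs) * p ^ length q)"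
    by (subst sum.reindex) (auto simp: inj_on_def power_add mult.commute case_prod_unfold)
  also have "\<dots> = (\<Sum>qs\<in>Q i. p ^ sum_list (map length qs) * (\<Sum>q\<in>E qs. p ^ length q))"
    unfolding P_def sum_distrib_left using IH(1) E by (subst sum.Sigma) auto
  also have "\<dots> \<le> (\<Sum>qs\<in>Q i. p ^ sum_list (map length qs) * c)"
    using E p by (intro sum_mono mult_left_mono) auto
  also have "\<dots> \<le> c ^ i * c"
    unfolding sum_distrib_right[symmetric] using IH(2) \<open>0 \<le> c\<close> by (rule mult_right_mono)
  finally show ?case
    using finite_subset[OF sub] finP by (simp add: mult.commute)
qed

section \<open>The first moment argument\<close>

text \<open>A union bound over at most \<open>2 ^ N\<close> vertex sets makes a sparse set occur
  with probability at most 1/4. The expected number of bad vertices is at most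
  \<open>N / 20\<close>, hence 1/2 after scaling by \<open>10 / N\<close>. Together this is below
  1.\<close>

lemma ex_random_graph:
  fixes V :: "'a set" and p c q :: real
  defines "E \<equiv> {e. e \<subseteq> V \<and> card e = 2}"
  assumes V: "finite V" "V \<noteq> {}" and p: "0 \<le> p" "p \<le> 1"
    and c: "real (2 + k * m) * (\<Sum>l<m. card V ^ l * p ^ Suc l) \<le> c" "card V * c ^ Suc k \<le> 1/20"
    and q: "2 ^ card V * exp (- p * q / 80) \<le> 1/4"
  obtains S where "S \<subseteq> E"
    "card {v \<in> V. \<exists>u\<in>V. u \<noteq> v \<and> k < card (short_starts {(a, b). {a, b} \<in> S} m v u)} < card V / 10"
    "\<And>X. X \<subseteq> V \<Longrightarrow> q \<le> (card X choose 2) \<Longrightarrow> 3/4 * p * (card X choose 2) < card {e \<in> S. e \<subseteq> X}"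
proof -
  have "E \<subseteq> Pow V"
    by (auto simp: E_def)
  then have E: "finite E"
    using V(1) by (meson finite_Pow_iff finite_subset)
  define N where "N = card V"
  have N: "0 < N"
    using V by (simp add: N_def card_gt_0_iff)
  define pairs :: "'a set \<Rightarrow> 'a set set" where "pairs X = {e. e \<subseteq> X \<and> card e = 2}" for X
  have pairs: "pairs X \<subseteq> E" "card (pairs X) = card X choose 2" if "X \<subseteq> V" for X
    using that n_subsets[of X 2] V(1) by (auto simp: pairs_def E_def intro: finite_subset)
  define \<X> where "\<X> = {X. X \<subseteq> V \<and> q \<le> (card X choose 2)}"
  have \<X>: "finite \<X>" "card \<X> \<le> 2 ^ N"
  proof -
    have "\<X> \<subseteq> Pow V"
      by (auto simp: \<X>_def)
    then show "finite \<X>" "card \<X> \<le> 2 ^ N"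
      using V(1) card_mono[of "Pow V" \<X>] by (auto simp: card_Pow N_def intro: finite_subset)
  qed
  define sparse :: "'a set set \<Rightarrow> 'a set \<Rightarrow> bool" where
    "sparse S X \<longleftrightarrow> card (S \<inter> pairs X) \<le> 3/4 * p * card (pairs X)" for S X
  define bad where
    "bad S = {v \<in> V. \<exists>u\<in>V. u \<noteq> v \<and> k < card (short_starts {(a, b). {a, b} \<in> S} m v u)}" for S
  define Q where "Q v u = {qs. ear_system V m v u qs \<and> length qs = Suc k}" for v u
  let ?w = "bernoulli_weight p E"
  have w: "0 \<le> ?w S" for S
    using bernoulli_weight_nonneg p by blast
  have Q: "finite (Q v u)" "(\<Sum>qs\<in>Q v u. p ^ sum_list (map length qs)) \<le> c ^ Suc k" for v u
    using sum_ear_systems_le[OF V(1) p(1) c(1), of "Suc k" v u] by (auto simp: Q_def)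
  have "(\<Sum>S\<in>Pow E. ?w S * of_bool (\<exists>X\<in>\<X>. sparse S X)) \<le> (\<Sum>S\<in>Pow E. ?w S * (\<Sum>X\<in>\<X>. of_bool (sparse S X)))"
  proof (intro sum_mono mult_left_mono w)
    fix S
    show "of_bool (\<exists>X\<in>\<X>. sparse S X) \<le> (\<Sum>X\<in>\<X>. of_bool (sparse S X) :: real)"
    proof (cases "\<exists>X\<in>\<X>. sparse S X")
      case True
      then obtain X where "X \<in> \<X>" "sparse S X"
        by blast
      then show ?thesis
        using member_le_sum[of X \<X> "\<lambda>X. of_bool (sparse S X) :: real"] \<X>(1) by auto
    qed (simp add: sum_nonneg)
  qed
  also have "\<dots> = (\<Sum>X\<in>\<X>. \<Sum>S\<in>Pow E. ?w S * of_bool (sparse S X))"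
    unfolding sum_distrib_left by (rule sum.swap)
  also have "\<dots> \<le> (\<Sum>X\<in>\<X>. exp (- p * q / 80))"
  proof (intro sum_mono)
    fix X assume X: "X \<in> \<X>"
    then have "(\<Sum>S\<in>Pow E. ?w S * of_bool (sparse S X)) \<le> exp (- p * card (pairs X) / 80)"
      unfolding sparse_def by (intro bernoulli_lower_tail E pairs p) (auto simp: \<X>_def)
    also have "\<dots> \<le> exp (- p * q / 80)"
    proof -
      have "p * q \<le> p * card (pairs X)"
        using X p(1) pairs(2)[of X] by (intro mult_left_mono) (auto simp: \<X>_def)
      then show ?thesis
        by simp
    qed
    finally show "(\<Sum>S\<in>Pow E. ?w S * of_bool (sparse S X)) \<le> exp (- p * q / 80)" .
  qed
  also have "\<dots> \<le> 2 ^ N * exp (- p * q / 80)"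
  proof -
    have "real (card \<X>) \<le> real (2 ^ N)"
      using \<X>(2) by (simp only: of_nat_le_iff)
    then show ?thesis
      by simp
  qed
  finally have 1: "(\<Sum>S\<in>Pow E. ?w S * of_bool (\<exists>X\<in>\<X>. sparse S X)) \<le> 1/4"
    using q by (simp add: N_def)
  \<comment> \<open>A bad \<open>v\<close> has, for some \<open>u\<close>, a system of
    \<open>k + 1\<close> ears with all edges in \<open>S\<close>; so the bad vertices are bounded by
    the number of triples \<open>v\<close>, \<open>u\<close>, \<open>qs\<close> present in
    \<open>S\<close>.\<close>
  have "(\<Sum>S\<in>Pow E. ?w S * card (bad S))
    \<le> (\<Sum>S\<in>Pow E. ?w S * (\<Sum>v\<in>V. \<Sum>u\<in>V. \<Sum>qs\<in>Q v u. of_bool (u \<noteq> v \<and> ear_edges v qs \<subseteq> S)))"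
  proof (intro sum_mono mult_left_mono w)
    fix S assume S: "S \<in> Pow E"
    have "real (card (bad S)) = (\<Sum>v\<in>V. of_bool (v \<in> bad S))"
      using V(1) by (simp add: bad_def Int_def)
    also have "\<dots> \<le> (\<Sum>v\<in>V. \<Sum>u\<in>V. \<Sum>qs\<in>Q v u. of_bool (u \<noteq> v \<and> ear_edges v qs \<subseteq> S))"
    proof (intro sum_mono)
      fix v assume "v \<in> V"
      show "of_bool (v \<in> bad S) \<le> (\<Sum>u\<in>V. \<Sum>qs\<in>Q v u. of_bool (u \<noteq> v \<and> ear_edges v qs \<subseteq> S) :: real)"
      proof (cases "v \<in> bad S")
        case True
        then obtain u where u: "u \<in> V" "u \<noteq> v" "Suc k \<le> card (short_starts {(a, b). {a, b} \<in> S} m v u)"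
          by (auto simp: bad_def)
        then obtain qs where qs: "qs \<in> Q v u" "ear_edges v qs \<subseteq> S"
          using ex_ear_system[OF V(1) _ u(2,3)] S by (auto simp: Q_def E_def)
        have "1 \<le> (\<Sum>qs\<in>Q v u. of_bool (u \<noteq> v \<and> ear_edges v qs \<subseteq> S) :: real)"
          using member_le_sum[OF qs(1), of "\<lambda>qs. of_bool (u \<noteq> v \<and> ear_edges v qs \<subseteq> S) :: real"]
            Q(1) qs(2) u(2) by simp
        also have "\<dots> \<le> (\<Sum>u\<in>V. \<Sum>qs\<in>Q v u. of_bool (u \<noteq> v \<and> ear_edges v qs \<subseteq> S))"
          using member_le_sum[OF u(1), of "\<lambda>u. \<Sum>qs\<in>Q v u. of_bool (u \<noteq> v \<and> ear_edges v qs \<subseteq> S) :: real"]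
            V(1) by (simp add: sum_nonneg)
        finally show ?thesis
          using True by simp
      qed (simp add: sum_nonneg)
    qed
    finally show "real (card (bad S)) \<le> (\<Sum>v\<in>V. \<Sum>u\<in>V. \<Sum>qs\<in>Q v u. of_bool (u \<noteq> v \<and> ear_edges v qs \<subseteq> S))" .
  qed
  also have "\<dots> = (\<Sum>v\<in>V. \<Sum>u\<in>V. \<Sum>qs\<in>Q v u. \<Sum>S\<in>Pow E. ?w S * of_bool (u \<noteq> v \<and> ear_edges v qs \<subseteq> S))"
    unfolding sum_distrib_left sum.swap[of _ _ "Pow E"] ..
  also have "\<dots> \<le> (\<Sum>v\<in>V. \<Sum>u\<in>V. \<Sum>qs\<in>Q v u. p ^ sum_list (map length qs))"
  proof (intro sum_mono)
    fix v u qs assume vu: "v \<in> V" "u \<in> V" and "qs \<in> Q v u"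
    then have qs: "ear_system V m v u qs"
      by (simp add: Q_def)
    have "ear_edges v qs \<subseteq> E"
    proof
      fix e assume "e \<in> ear_edges v qs"
      then obtain r where r: "r \<in> set qs" "e \<in> path_edges (v # r)"
        by (auto simp: ear_edges_def)
      with ear_system_distinct[OF qs r(1)] have "distinct (v # r)" "set (v # r) \<subseteq> V"
        using vu by auto
      with r(2) show "e \<in> E"
        using path_edges_subset card_in_path_edges unfolding E_def by blast
    qed
    then have "(\<Sum>S\<in>Pow E. ?w S * of_bool (ear_edges v qs \<subseteq> S)) = p ^ sum_list (map length qs)"
      using bernoulli_superset[OF E] card_ear_edges[OF qs] by simp
    moreover have "(\<Sum>S\<in>Pow E. ?w S * of_bool (u \<noteq> v \<and> ear_edges v qs \<subseteq> S)) \<le> (\<Sum>S\<in>Pow E. ?w S * of_bool (ear_edges v qs \<subseteq> S))"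
      by (intro sum_mono mult_left_mono w) auto
    ultimately show "(\<Sum>S\<in>Pow E. ?w S * of_bool (u \<noteq> v \<and> ear_edges v qs \<subseteq> S)) \<le> p ^ sum_list (map length qs)"
      by simp
  qed
  also have "\<dots> \<le> (\<Sum>v\<in>V. \<Sum>u\<in>V. c ^ Suc k)"
    by (intro sum_mono Q(2))
  also have "\<dots> = N * (N * c ^ Suc k)"
    by (simp add: N_def)
  also have "\<dots> \<le> N * (1/20)"
    using c(2) by (intro mult_left_mono) (auto simp: N_def)
  finally have "(\<Sum>S\<in>Pow E. ?w S * card (bad S)) * (10 / N) \<le> N * (1/20) * (10 / N)"
    by (intro mult_right_mono) auto
  then have 2: "(\<Sum>S\<in>Pow E. ?w S * (card (bad S) * (10 / N))) \<le> 1/2"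
  proof -
    have "(\<Sum>S\<in>Pow E. ?w S * (card (bad S) * (10 / N))) = (\<Sum>S\<in>Pow E. ?w S * card (bad S)) * (10 / N)"
      by (simp only: sum_distrib_right mult.assoc)
    moreover have "N * (1/20) * (10 / N) = (1/2 :: real)"
      using N by simp
    ultimately show ?thesis
      using \<open>_ \<le> N * (1/20) * (10 / N)\<close> by (simp only:)
  qed
  \<comment> \<open>Both failures enter one nonnegative quantity: a value below 1 excludes sparse
    sets and leaves fewer than \<open>N / 10\<close> bad vertices.\<close>
  have "(\<Sum>S\<in>Pow E. ?w S * (of_bool (\<exists>X\<in>\<X>. sparse S X) + card (bad S) * (10 / N))) < 1"
    unfolding distrib_left sum.distrib using 1 2 by simp
  then obtain S where S: "S \<subseteq> E" "of_bool (\<exists>X\<in>\<X>. sparse S X) + card (bad S) * (10 / N) < 1"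
    by (rule bernoulli_first_moment[OF E p])
  have "0 \<le> card (bad S) * (10 / N)"
    by simp
  with S(2) have "of_bool (\<exists>X\<in>\<X>. sparse S X) < (1 :: real)"
    by linarith
  then have dense: "\<not> (\<exists>X\<in>\<X>. sparse S X)"
    unfolding of_bool_less_one_iff .
  show ?thesis
  proof (rule that[OF S(1)])
    have "card (bad S) * (10 / N) < 1"
      using S(2) dense by simp
    then show "card {v \<in> V. \<exists>u\<in>V. u \<noteq> v \<and> k < card (short_starts {(a, b). {a, b} \<in> S} m v u)} < card V / 10"
      using N unfolding bad_def N_def by (simp add: field_simps)
    fix X assume X: "X \<subseteq> V" "q \<le> (card X choose 2)"
    then have "\<not> sparse S X"
      using dense by (auto simp: \<X>_def)
    moreover have "S \<inter> pairs X = {e \<in> S. e \<subseteq> X}"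
      using S(1) by (auto simp: pairs_def E_def)
    ultimately show "3/4 * p * (card X choose 2) < card {e \<in> S. e \<subseteq> X}"
      using pairs(2)[OF X(1)] by (simp add: sparse_def not_le)
  qed
qed

text \<open>A set of \<open>x > a\<close> vertices spans more than
  \<open>3/8 * p * x * (x - 1)\<close> edges. If \<open>P\<close> has at most
  \<open>j * k * x\<close> arcs on it, then \<open>x < 1 + 8/3 * j * k / p\<close>, so with
  \<open>1 \<le> a\<close> the summands of \<open>loss\<close> bound the discarded sets.\<close>

lemma IR_oriented_trees_le:
  fixes p c a :: real
  assumes N: "0 < N" and p: "0 < p" "p \<le> 1"
    and c: "real (2 + k * (n - 1)) * (\<Sum>l<n - 1. real N ^ l * p ^ Suc l) \<le> c" "N * c ^ Suc k \<le> 1/20"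
    and a: "1 \<le> a" "2 ^ N * exp (- p * (a * (a - 1) / 2) / 80) \<le> 1/4"
    and loss: "(\<Sum>j\<in>{1..<n}. a + 8/3 * real j * k / p) \<le> 9/10 * N"
  shows "IR (oriented_trees n) \<le> enat N"
proof -
  define V where "V = {..<N}"
  have V: "finite V" "V \<noteq> {}" "card V = N"
    using N by (auto simp: V_def)
  \<comment> \<open>This is "a choose 2" for a real number \<open>a\<close>, so every set with more
    than \<open>a\<close> vertices has at least \<open>q\<close> pairs.\<close>
  define q where "q = a * (a - 1) / 2"
  obtain S where S: "S \<subseteq> {e. e \<subseteq> V \<and> card e = 2}"
    "card {v \<in> V. \<exists>u\<in>V. u \<noteq> v \<and> k < card (short_starts {(a, b). {a, b} \<in> S} (n - 1) v u)} < card V / 10"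
    "\<And>X. X \<subseteq> V \<Longrightarrow> q \<le> (card X choose 2) \<Longrightarrow> 3/4 * p * (card X choose 2) < card {e \<in> S. e \<subseteq> X}"
  proof (rule ex_random_graph[OF V(1,2), of p k "n - 1" c q])
    show "real (2 + k * (n - 1)) * (\<Sum>l<n - 1. card V ^ l * p ^ Suc l) \<le> c"
      using c(1) V(3) by simp
  qed (use p c(2) a(2) V(3) in \<open>auto simp: q_def\<close>)
  define G where "G = \<lparr>pverts = V, parcs = {(a, b). {a, b} \<in> S}\<rparr>"
  have edge: "a \<in> V" "b \<in> V" "a \<noteq> b" if "{a, b} \<in> S" for a b
    using S(1) that by (auto simp: card_2_iff)
  interpret G: pair_graph G
  proof
    have "parcs G \<subseteq> V \<times> V"
      using edge by (auto simp: G_def)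
    then show "finite (parcs G)"
      using V(1) finite_subset by blast
    show "symmetric (with_proj G)"
      unfolding symmetric_def by (auto simp: G_def insert_commute intro!: symI)
  qed (use V(1) edge in \<open>auto simp: G_def\<close>)
  define W where "W = V - {v \<in> V. \<exists>u\<in>V. u \<noteq> v \<and> k < card (short_starts (parcs G) (n - 1) v u)}"
  have "9/10 * N < card W"
    using S(2) V unfolding W_def G_def by (subst card_Diff_subset) (auto simp: of_nat_diff card_mono)
  then have big: "(\<Sum>j\<in>{1..<n}. a + 8/3 * real j * k / p) < card W"
    using loss by simp
  have dense: "real (card X) \<le> a + 8/3 * real j * k / p"
    if P: "P \<union> P\<inverse> = parcs G" and X: "X \<subseteq> pverts G" and few: "card (P \<inter> X \<times> X) \<le> j * k * card X" for P X j
  proof (rule ccontr)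
    assume *: "\<not> ?thesis"
    define x where "x = real (card X)"
    have X': "X \<subseteq> V" "finite X"
      using X V(1) by (auto simp: G_def intro: finite_subset)
    have jk: "0 \<le> 8/3 * real j * k / p"
      using p by simp
    then have x: "a < x" "a + 8/3 * real j * k / p < x"
      using * by (auto simp: x_def)
    have choose: "real (card X choose 2) = x * (x - 1) / 2"
    proof -
      have "2 dvd card X * (card X - 1)"
        by auto
      then have "real (card X choose 2) = real (card X * (card X - 1)) / real 2"
        unfolding choose_two by (rule real_of_nat_div)
      moreover have "1 \<le> card X"
        using x(1) a(1) by (simp add: x_def)
      ultimately show ?thesis
        by (simp add: x_def of_nat_diff)
    qed
    have "q \<le> x * (x - 1) / 2"
      unfolding q_def using x(1) a(1) by (intro divide_right_mono mult_mono) auto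
    then have "3/4 * p * (x * (x - 1) / 2) < card {e \<in> S. e \<subseteq> X}"
      using S(3)[OF X'(1)] choose by simp
    \<comment> \<open>Every edge inside \<open>X\<close> is oriented by \<open>P\<close> in at least
      one direction, so forgetting directions maps the arcs onto the edges.\<close>
    also have "card {e \<in> S. e \<subseteq> X} \<le> card (P \<inter> X \<times> X)"
    proof (rule surj_card_le)
      show "finite (P \<inter> X \<times> X)"
        using X'(2) by simp
      show "{e \<in> S. e \<subseteq> X} \<subseteq> (\<lambda>(a, b). {a, b}) ` (P \<inter> X \<times> X)"
      proof
        fix e assume e: "e \<in> {e \<in> S. e \<subseteq> X}"
        then obtain a b where ab: "e = {a, b}"
          using S(1) by (auto simp: card_2_iff)
        then have "(a, b) \<in> parcs G"
          using e by (simp add: G_def)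
        then have "(a, b) \<in> P \<or> (b, a) \<in> P"
          using P by blast
        then show "e \<in> (\<lambda>(a, b). {a, b}) ` (P \<inter> X \<times> X)"
          using e ab by (auto simp: insert_commute intro: image_eqI[of _ _ "(a, b)"] image_eqI[of _ _ "(b, a)"])
      qed
    qed
    also have "real (card (P \<inter> X \<times> X)) \<le> real (j * k * card X)"
      using few by (simp only: of_nat_le_iff)
    finally have "(3/8 * p * (x - 1)) * x < (j * k) * x"
      by (simp add: x_def algebra_simps)
    then have "3/8 * p * (x - 1) < j * k"
      using x(1) a(1) by (simp add: mult_less_cancel_right)
    then have "x - 1 < 8/3 * real j * k / p"
      using p(1) by (simp add: field_simps)
    with x(2) a(1) show False
      by simp
  qed
  have "arrows G H" if "H \<in> oriented_trees n" for H
  proof (rule G.arrows_oriented_tree[OF _ _ _ big that])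
    show "card (short_starts (parcs G) (n - 1) v u) \<le> k" if "v \<in> W" "u \<in> W" "u \<noteq> v" for v u
      using that by (force simp: W_def not_less)
  qed (use dense in \<open>auto simp: W_def G_def\<close>)
  then have "enat (card (pverts G)) \<in> {enat (card (pverts G)) | G :: nat pair_pre_digraph.
      pair_graph G \<and> arrows_class G (oriented_trees n)}"
    using G.pair_graph unfolding arrows_class_def by blast
  then have "IR (oriented_trees n) \<le> enat (card (pverts G))"
    unfolding IR_def by (rule Inf_lower)
  then show ?thesis
    using V(3) by (simp add: G_def)
qed

section \<open>Choice of the parameters\<close>

lemma sum_powers_le:
  fixes d :: real
  assumes "2 \<le> d"
  shows "(\<Sum>l<m. d ^ Suc l) \<le> 2 * d ^ m"
proof (induction m)
  case (Suc m)
  have "2 * d ^ m \<le> d * d ^ m"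
    using assms by (intro mult_right_mono) auto
  then show ?case
    using Suc by simp
qed simp

text \<open>Here \<open>d = p * N\<close> is the approximate average degree and
  \<open>M = exp 1 * d\<close>, so \<open>d ^ n / M ^ n = exp (- n)\<close>; this pays for one ear,
  and \<open>k\<close> about \<open>ln M\<close> ears pay for the factor \<open>N\<close>.\<close>

lemma IR_oriented_trees_le_power:
  fixes n :: nat
  defines "M \<equiv> 4 * exp 1 * (real n)\<^sup>2 * ln n"
  assumes n: "3 \<le> n" "384000 \<le> ln n"
    and k1: "2 + (ln M + 1) * n \<le> (real n)\<^sup>2 * ln n"
    and k2: "ln M + 1 \<le> 5/2 * ln n"
  shows "IR (oriented_trees n) \<le> enat (nat \<lfloor>M ^ n\<rfloor>)"
proof -
  define d where "d = 4 * (real n)\<^sup>2 * ln n"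
  define N where "N = nat \<lfloor>M ^ n\<rfloor>"
  define k where "k = nat \<lceil>ln M\<rceil>"
  define p where "p = d / N"
  define a where "a = N / (40 * real n)"
  have M: "M = exp 1 * d"
    by (simp add: M_def d_def)
  have e: "2 \<le> exp (1 :: real)"
    using exp_ge_add_one_self[of 1] by simp
  have n2: "9 \<le> (real n)\<^sup>2" "3 * n \<le> (real n)\<^sup>2"
    using n(1) power_mono[of 3 "real n" 2] mult_right_mono[of 3 "real n" "real n"]
    by (auto simp: power2_eq_square)
  have "4 * (real n)\<^sup>2 * 384000 \<le> d"
    unfolding d_def using n(2) by (intro mult_left_mono) auto
  then have d: "1000 \<le> d" "1000 * n \<le> d"
    using n2 by auto
  have Md: "2 * d \<le> M"
    unfolding M using e d(1) by (intro mult_right_mono) auto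
  then have M1: "1 < M" "0 < M"
    using d(1) by auto
  have "M ^ 1 \<le> M ^ n"
    using M1 n(1) by (intro power_increasing) auto
  then have Mn: "M \<le> M ^ n"
    by simp
  have N_eq: "real N = of_int \<lfloor>M ^ n\<rfloor>"
    using M1 by (simp add: N_def)
  have N_le: "N \<le> M ^ n"
    unfolding N_eq by linarith
  \<comment> \<open>Rounding down loses less than 1, which is at most half of
    \<open>M ^ n\<close>.\<close>
  have N_ge: "M ^ n / 2 \<le> N"
    using Mn Md d(1) unfolding N_eq by linarith
  then have Nd: "d \<le> N"
    using Mn Md by linarith
  then have N0: "0 < N" "1 \<le> real N"
    using d(1) by (auto intro: Suc_leI)
  have lnM: "0 < ln M"
    using M1 by simp
  have k: "ln M \<le> k" "k \<le> ln M + 1"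
    using lnM unfolding k_def by linarith+
  have "IR (oriented_trees n) \<le> enat N"
  proof (rule IR_oriented_trees_le[where p = p and k = k and c = "exp (- real n)" and a = a])
    show "0 < N" by fact
    show "0 < p" "p \<le> 1"
      using N0 Nd d(1) by (auto simp: p_def)
    \<comment> \<open>The sum over ear lengths is geometric, at most
      \<open>2 * d ^ (n - 1) / N\<close> and hence at most \<open>exp (- n) * 4 / d\<close>;
      \<open>k1\<close> bounds the number of possible ends by \<open>d / 4\<close>.\<close>
    show "real (2 + k * (n - 1)) * (\<Sum>l<n - 1. real N ^ l * p ^ Suc l) \<le> exp (- real n)"
    proof -
      have "real (2 + k * (n - 1)) \<le> 2 + k * real n"
        using n(1) by (simp add: mult_left_mono of_nat_diff)
      also have "\<dots> \<le> 2 + (ln M + 1) * n"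
        using k(2) by (intro add_mono mult_right_mono) auto
      also have "\<dots> \<le> d / 4"
        using k1 by (simp add: d_def)
      finally have 1: "real (2 + k * (n - 1)) \<le> d / 4" .
      have "(\<Sum>l<n - 1. real N ^ l * p ^ Suc l) = (\<Sum>l<n - 1. d ^ Suc l) / N"
        using N0 unfolding sum_divide_distrib
        by (intro sum.cong) (auto simp: p_def power_divide)
      also have "\<dots> \<le> 2 * d ^ (n - 1) / N"
        using sum_powers_le d(1) by (intro divide_right_mono) auto
      also have "\<dots> \<le> 2 * d ^ (n - 1) / (M ^ n / 2)"
        using N_ge N0 M1 d(1) by (intro divide_left_mono mult_pos_pos) auto
      also have "\<dots> = 4 * d ^ (n - 1) / (exp n * d ^ n)"
        by (simp add: M power_mult_distrib exp_of_nat_mult[symmetric])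
      also have "d ^ n = d * d ^ (n - 1)"
        using n(1) by (cases n) auto
      also have "4 * d ^ (n - 1) / (exp n * (d * d ^ (n - 1))) = exp (- real n) * 4 / d"
        unfolding exp_minus using d(1) by (simp add: field_simps)
      finally have 2: "(\<Sum>l<n - 1. real N ^ l * p ^ Suc l) \<le> exp (- real n) * 4 / d" .
      have "real (2 + k * (n - 1)) * (\<Sum>l<n - 1. real N ^ l * p ^ Suc l)
          \<le> d / 4 * (exp (- real n) * 4 / d)"
        using 1 2 d(1) by (intro mult_mono) (auto simp: p_def intro!: sum_nonneg)
      then show ?thesis
        using d(1) by simp
    qed
    \<comment> \<open>Because \<open>k\<close> is at least \<open>ln M\<close>, the power is at most
      \<open>exp (- n) / M ^ n\<close>, which absorbs \<open>N\<close>.\<close>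
    show "real N * exp (- real n) ^ Suc k \<le> 1/20"
    proof -
      have "exp (- real n) ^ Suc k = exp (- (real n * (k + 1)))"
        unfolding exp_of_nat_mult[symmetric] by (simp add: algebra_simps)
      also have "\<dots> \<le> exp (- (real n * (ln M + 1)))"
        using k(1) by (simp add: mult_left_mono)
      also have "\<dots> = exp (- real n) / M ^ n"
        using M1 exp_of_nat_mult[of n "ln M"] by (simp add: algebra_simps exp_diff exp_minus field_simps)
      finally have "real N * exp (- real n) ^ Suc k \<le> M ^ n * (exp (- real n) / M ^ n)"
        using N_le M1 by (intro mult_mono) auto
      also have "\<dots> = exp (- real n)"
        using M1 by simp
      also have "\<dots> \<le> exp (- 20)"
      proof -
        have "ln n \<le> real n"
          using ln_le_minus_one[of "real n"] n(1) by simp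
        then show ?thesis
          using n(2) by simp
      qed
      also have "\<dots> \<le> 1/20"
        using exp_ge_add_one_self[of 20] by (simp add: exp_minus field_simps)
      finally show ?thesis .
    qed
    have "80 * n \<le> real N"
      using d(2) Nd by simp
    then have a2: "2 \<le> a"
      using n(1) by (simp add: a_def field_simps)
    then show "1 \<le> a" by simp
    \<comment> \<open>The exponent is at most \<open>- N * ln n / 128000\<close>. The threshold
      384000 = 3 * 128000 makes this at most \<open>- 3 * N\<close>, enough to beat
      \<open>2 ^ N\<close>.\<close>
    show "2 ^ N * exp (- p * (a * (a - 1) / 2) / 80) \<le> 1/4"
    proof -
      have "p * (a\<^sup>2 / 4) \<le> p * (a * (a - 1) / 2)"
      proof (rule mult_left_mono)
        have "a * 2 \<le> a * a"
          using a2 by (intro mult_left_mono) auto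
        then show "a\<^sup>2 / 4 \<le> a * (a - 1) / 2"
          by (simp add: power2_eq_square algebra_simps)
      qed (use \<open>0 < N\<close> d(1) in \<open>simp add: p_def\<close>)
      moreover have "p * (a\<^sup>2 / 4) = N * (ln n / 1600)"
        using n(1) N0 by (simp add: p_def a_def d_def power2_eq_square)
      ultimately have "- p * (a * (a - 1) / 2) / 80 \<le> - (N * (ln n / 128000))"
        by simp
      also have "\<dots> \<le> - (real N * 3)"
        using n(2) by (intro le_imp_neg_le mult_left_mono) auto
      finally have "exp (- p * (a * (a - 1) / 2) / 80) \<le> exp (- (real N * 3))"
        by simp
      moreover have "2 ^ N \<le> exp (real N)"
        using power_mono[OF e, of N] exp_of_nat_mult[of N "1 :: real"] by simp
      ultimately have "2 ^ N * exp (- p * (a * (a - 1) / 2) / 80) \<le> exp (real N) * exp (- (real N * 3))"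
        by (intro mult_mono) auto
      also have "\<dots> = exp (- (2 * real N))"
        by (simp add: exp_add[symmetric])
      also have "\<dots> \<le> exp (- 2)"
        using N0 by simp
      also have "\<dots> \<le> 1/4"
      proof -
        have "2 * 2 \<le> exp 1 * exp (1 :: real)"
          using e by (intro mult_mono) auto
        then show ?thesis
          by (simp add: exp_add[symmetric] exp_minus field_simps)
      qed
      finally show ?thesis .
    qed
    \<comment> \<open>The terms \<open>a\<close> give at most \<open>N / 40\<close>. The rest gives
      at most \<open>k * N / (3 * ln n)\<close>, where the factor 4 of \<open>d\<close> enters, and
      this is at most \<open>5/6 * N\<close> by \<open>k2\<close>; the sum stays below
      \<open>9/10 * N\<close>.\<close>
    show "(\<Sum>j\<in>{1..<n}. a + 8/3 * real j * k / p) \<le> 9/10 * N"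
    proof -
      have gauss: "(\<Sum>j\<in>{1..<n}. real j) \<le> (real n)\<^sup>2 / 2"
      proof (induction n)
        case (Suc n)
        then show ?case
          by (cases n) (auto simp: power2_eq_square field_simps)
      qed simp
      have "(\<Sum>j\<in>{1..<n}. a + 8/3 * real j * k / p) = (\<Sum>j\<in>{1..<n}. a + real j * (8/3 * k / p))"
        by (intro sum.cong) auto
      also have "\<dots> = real (n - 1) * a + (\<Sum>j\<in>{1..<n}. real j) * (8/3 * k / p)"
        unfolding sum.distrib sum_distrib_right by simp
      also have "\<dots> \<le> n * a + (real n)\<^sup>2 / 2 * (8/3 * k / p)"
        using gauss a2 d(1) N0 by (intro add_mono mult_right_mono) (auto simp: p_def)
      also have "n * a = N / 40"
        using n(1) by (simp add: a_def)
      also have "(real n)\<^sup>2 / 2 * (8/3 * k / p) = k * (N / (3 * ln n))"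
        using n d(1) N0 by (simp add: p_def d_def field_simps)
      also have "\<dots> \<le> 5/2 * ln n * (N / (3 * ln n))"
        using k(2) k2 n(2) by (intro mult_right_mono) auto
      also have "\<dots> = 5/6 * N"
        using n(2) by simp
      finally show ?thesis
        using N0 by simp
    qed
  qed
  then show ?thesis
    by (simp add: N_def)
qed

theorem theorem4p5:
  fixes \<epsilon> :: real
  assumes "0 < \<epsilon>" and "\<epsilon> < 1"
  shows "\<exists>N :: nat. \<forall>n \<ge> N.
    ereal_of_enat (IR (oriented_trees n))
      \<le> ereal ((4 * exp 1 * (1 + \<epsilon>) * (real n)\<^sup>2 * ln (real n)) ^ n)"
proof -
  define M where "M n = 4 * exp 1 * (real n)\<^sup>2 * ln n" for n
  have "\<forall>\<^sub>F n in sequentially. 3 \<le> n"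
    by (rule eventually_ge_at_top)
  moreover have "\<forall>\<^sub>F n in sequentially. 384000 \<le> ln (real n)"
    by real_asymp
  moreover have "\<forall>\<^sub>F n in sequentially. 2 + (ln (M n) + 1) * n \<le> (real n)\<^sup>2 * ln n"
    unfolding M_def by real_asymp
  \<comment> \<open>The leading term of \<open>ln (M n)\<close> is \<open>2 * ln n\<close>, which
    leaves room below \<open>5/2 * ln n\<close>.\<close>
  moreover have "\<forall>\<^sub>F n in sequentially. ln (M n) + 1 \<le> 5/2 * ln n"
    unfolding M_def by real_asymp
  ultimately have "\<forall>\<^sub>F n in sequentially. ereal_of_enat (IR (oriented_trees n))
      \<le> ereal ((4 * exp 1 * (1 + \<epsilon>) * (real n)\<^sup>2 * ln (real n)) ^ n)"
  proof eventually_elim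
    case (elim n)
    then have "0 \<le> M n"
      by (simp add: M_def)
    have "IR (oriented_trees n) \<le> enat (nat \<lfloor>M n ^ n\<rfloor>)"
      using IR_oriented_trees_le_power[of n] elim by (simp add: M_def)
    then have "ereal_of_enat (IR (oriented_trees n)) \<le> ereal_of_enat (enat (nat \<lfloor>M n ^ n\<rfloor>))"
      by (simp only: ereal_of_enat_le_iff)
    also have "\<dots> \<le> ereal (M n ^ n)"
      using \<open>0 \<le> M n\<close> by simp
    also have "\<dots> \<le> ereal ((M n * (1 + \<epsilon>)) ^ n)"
      using \<open>0 \<le> M n\<close> assms mult_left_mono[of 1 "1 + \<epsilon>" "M n"] by (auto intro!: power_mono)
    also have "M n * (1 + \<epsilon>) = 4 * exp 1 * (1 + \<epsilon>) * (real n)\<^sup>2 * ln (real n)"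
      by (simp add: M_def mult_ac)
    finally show ?case .
  qed
  then show ?thesis
    unfolding eventually_sequentially .
qed

end
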